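(* Let $K$ be an arbitrary ring, $u_1,\dots,u_n\in\Lambda_n(K)$, and let $a\in\Lambda_n(K)$ be an unknown. Then the system of equations $$x_1a=u_1,\quad x_2a=u_2,\quad\dots,\quad x_na=u_n$$ has a solution in $\Lambda_n$ if and only if the following two conditions hold: 1. $u_1\in(x_1),\dots,u_n\in(x_n)$, and 2. $x_iu_j=-x_ju_i$ for all $i\ne j$. In this case, $$a=x_1\cdots x_na_n+\sum_{i=1}^{n-1}x_1\cdots x_i\,\partial_i\cdots\partial_1\partial_{i+1}(u_{i+1})+\partial_1(u_1),\qquad a_n\in K,$$ are all the solutions.
   Context: $K$ is an associative ring with $1$, not necessarily commutative. $\Lambda_n=\Lambda_n(K)$ is the Grassmann ring generated freely over $K$ by $x_1,\dots,x_n$ (commuting with the elements of $K$) subject to $x_i^2=0$, $x_ix_j=-x_jx_i$ ($i\ne j$); $\Lambda_n=\bigoplus_\alpha Kx^\alpha=\bigoplus_\alpha x^\alpha K$ with $x^\alpha=x_{i_1}\cdots x_{i_k}$, $\alpha=\{i_1<\dots<i_k\}\subseteq\{1,\dots,n\}$, graded by $|\alpha|$ with components $\Lambda_{n,d}$. $(x_i)=x_i\Lambda_n=\Lambda_nx_i$ is the ideal generated by $x_i$. $\partial_i=\partial/\partial x_i$ is the left skew $K$-derivation of $\Lambda_n$: the additive map vanishing on $K$ with $\partial_i(x_j)=\delta_{ij}$ and $\partial_i(bc)=\partial_i(b)c+(-1)^db\,\partial_i(c)$ for $b\in\Lambda_{n,d}$, $c\in\Lambda_n$. *)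

theory Defs
  imports "HOL-Algebra.Ideal"
begin

section \<open>The Grassmann ring\<close>

definition signed :: "('a, 'm) ring_scheme \<Rightarrow> nat \<Rightarrow> 'a \<Rightarrow> 'a" where
  "signed K m c = (if even m then c else \<ominus>\<^bsub>K\<^esub> c)"

definition inversions :: "nat set \<Rightarrow> nat set \<Rightarrow> nat" where
  "inversions \<alpha> \<beta> = card {(i, j). i \<in> \<alpha> \<and> j \<in> \<beta> \<and> j < i}"

text \<open>
  An element of the Grassmann ring on \<open>x\<^sub>1, \<dots>, x\<^sub>n\<close> is represented by its family of coefficients,
  so that \<open>a\<close> stands for the sum of all \<open>a(\<alpha>) x\<^sup>\<alpha>\<close>, \<open>\<alpha> \<subseteq> {1..n}\<close>. The product is the one determined by
  \<open>x\<^sup>\<alpha> x\<^sup>\<beta> = (-1)\<^sup>k x\<^sup>\<gamma>\<close> for disjoint \<open>\<alpha>, \<beta>\<close> with union \<open>\<gamma>\<close>, where \<open>k\<close> is the number of inversions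
  that are removed when \<open>x\<^sup>\<alpha> x\<^sup>\<beta>\<close> is sorted, and by \<open>x\<^sup>\<alpha> x\<^sup>\<beta> = 0\<close> if \<open>\<alpha>\<close> and \<open>\<beta>\<close> meet.
\<close>

definition grassmann :: "('a, 'm) ring_scheme \<Rightarrow> nat \<Rightarrow> (nat set \<Rightarrow> 'a) ring" where
  "grassmann K n =
    \<lparr> carrier = Pow {1..n} \<rightarrow>\<^sub>E carrier K,
      mult = (\<lambda>a b. \<lambda>\<gamma>\<in>Pow {1..n}.
        \<Oplus>\<^bsub>K\<^esub>\<alpha>\<in>Pow \<gamma>. signed K (inversions \<alpha> (\<gamma> - \<alpha>)) (a \<alpha> \<otimes>\<^bsub>K\<^esub> b (\<gamma> - \<alpha>))),
      one = (\<lambda>\<gamma>\<in>Pow {1..n}. if \<gamma> = {} then \<one>\<^bsub>K\<^esub> else \<zero>\<^bsub>K\<^esub>),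
      zero = (\<lambda>\<gamma>\<in>Pow {1..n}. \<zero>\<^bsub>K\<^esub>),
      add = (\<lambda>a b. \<lambda>\<gamma>\<in>Pow {1..n}. a \<gamma> \<oplus>\<^bsub>K\<^esub> b \<gamma>) \<rparr>"

definition gmonom :: "('a, 'm) ring_scheme \<Rightarrow> nat \<Rightarrow> nat set \<Rightarrow> 'a \<Rightarrow> (nat set \<Rightarrow> 'a)" where
  "gmonom K n \<alpha> c = (\<lambda>\<gamma>\<in>Pow {1..n}. if \<gamma> = \<alpha> then c else \<zero>\<^bsub>K\<^esub>)"

definition gconst :: "('a, 'm) ring_scheme \<Rightarrow> nat \<Rightarrow> 'a \<Rightarrow> (nat set \<Rightarrow> 'a)" where
  "gconst K n c = gmonom K n {} c"

definition gvar :: "('a, 'm) ring_scheme \<Rightarrow> nat \<Rightarrow> nat \<Rightarrow> (nat set \<Rightarrow> 'a)" where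
  "gvar K n i = gmonom K n {i} \<one>\<^bsub>K\<^esub>"

definition gvar_prod :: "('a, 'm) ring_scheme \<Rightarrow> nat \<Rightarrow> nat list \<Rightarrow> (nat set \<Rightarrow> 'a)" where
  "gvar_prod K n is = foldr (\<lambda>i p. gvar K n i \<otimes>\<^bsub>grassmann K n\<^esub> p) is \<one>\<^bsub>grassmann K n\<^esub>"

definition gcomponent :: "('a, 'm) ring_scheme \<Rightarrow> nat \<Rightarrow> nat \<Rightarrow> (nat set \<Rightarrow> 'a) set" where
  "gcomponent K n d =
    {a \<in> carrier (grassmann K n). \<forall>\<alpha>\<in>Pow {1..n}. card \<alpha> \<noteq> d \<longrightarrow> a \<alpha> = \<zero>\<^bsub>K\<^esub>}"

definition is_gpartial ::
    "('a, 'm) ring_scheme \<Rightarrow> nat \<Rightarrow> nat \<Rightarrow> ((nat set \<Rightarrow> 'a) \<Rightarrow> (nat set \<Rightarrow> 'a)) \<Rightarrow> bool" where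
  "is_gpartial K n i D \<longleftrightarrow>
    (let L = grassmann K n in
      D \<in> carrier L \<rightarrow> carrier L \<and>
      (\<forall>b\<in>carrier L. \<forall>c\<in>carrier L. D (b \<oplus>\<^bsub>L\<^esub> c) = D b \<oplus>\<^bsub>L\<^esub> D c) \<and>
      (\<forall>c\<in>carrier K. D (gconst K n c) = \<zero>\<^bsub>L\<^esub>) \<and>
      (\<forall>j\<in>{1..n}. D (gvar K n j) = (if i = j then \<one>\<^bsub>L\<^esub> else \<zero>\<^bsub>L\<^esub>)) \<and>
      (\<forall>d. \<forall>b\<in>gcomponent K n d. \<forall>c\<in>carrier L.
        D (b \<otimes>\<^bsub>L\<^esub> c) =
          D b \<otimes>\<^bsub>L\<^esub> c \<oplus>\<^bsub>L\<^esub> (\<ominus>\<^bsub>L\<^esub> \<one>\<^bsub>L\<^esub>) [^]\<^bsub>L\<^esub> d \<otimes>\<^bsub>L\<^esub> (b \<otimes>\<^bsub>L\<^esub> D c)))"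

text \<open>
  Extensionality fixes the value outside the carrier, which makes the description unique;
  see \<open>gpartial_ex1\<close> below.
\<close>

definition gpartial ::
    "('a, 'm) ring_scheme \<Rightarrow> nat \<Rightarrow> nat \<Rightarrow> (nat set \<Rightarrow> 'a) \<Rightarrow> (nat set \<Rightarrow> 'a)" where
  "gpartial K n i = (THE D. D \<in> extensional (carrier (grassmann K n)) \<and> is_gpartial K n i D)"


section \<open>Signs and finite sums\<close>

lemma inversions_Un_left:
  assumes "finite \<alpha>" "finite \<beta>" "finite \<gamma>" "\<alpha> \<inter> \<beta> = {}"
  shows "inversions (\<alpha> \<union> \<beta>) \<gamma> = inversions \<alpha> \<gamma> + inversions \<beta> \<gamma>"
proof -
  have fin: "finite {(i, j). i \<in> A \<and> j \<in> \<gamma> \<and> j < i}" if "finite A" for A :: "nat set"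
    by (rule finite_subset[of _ "A \<times> \<gamma>"]) (use that assms in auto)
  have "{(i, j). i \<in> \<alpha> \<union> \<beta> \<and> j \<in> \<gamma> \<and> j < i} =
      {(i, j). i \<in> \<alpha> \<and> j \<in> \<gamma> \<and> j < i} \<union> {(i, j). i \<in> \<beta> \<and> j \<in> \<gamma> \<and> j < i}"
    by auto
  then show ?thesis
    unfolding inversions_def using assms by (simp add: fin card_Un_disjoint disjoint_iff)
qed

lemma inversions_Un_right:
  assumes "finite \<alpha>" "finite \<beta>" "finite \<gamma>" "\<alpha> \<inter> \<beta> = {}"
  shows "inversions \<gamma> (\<alpha> \<union> \<beta>) = inversions \<gamma> \<alpha> + inversions \<gamma> \<beta>"
proof -
  have fin: "finite {(i, j). i \<in> \<gamma> \<and> j \<in> A \<and> j < i}" if "finite A" for A :: "nat set"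
    by (rule finite_subset[of _ "\<gamma> \<times> A"]) (use that assms in auto)
  have "{(i, j). i \<in> \<gamma> \<and> j \<in> \<alpha> \<union> \<beta> \<and> j < i} =
      {(i, j). i \<in> \<gamma> \<and> j \<in> \<alpha> \<and> j < i} \<union> {(i, j). i \<in> \<gamma> \<and> j \<in> \<beta> \<and> j < i}"
    by auto
  then show ?thesis
    unfolding inversions_def using assms by (simp add: fin card_Un_disjoint disjoint_iff)
qed

lemma inversions_empty [simp]: "inversions {} \<beta> = 0" "inversions \<alpha> {} = 0"
  by (auto simp: inversions_def)

lemma inversions_single_left: "inversions {i} \<beta> = card {j \<in> \<beta>. j < i}"
proof -
  have "{(k, j). k \<in> {i} \<and> j \<in> \<beta> \<and> j < k} = Pair i ` {j \<in> \<beta>. j < i}"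
    by auto
  then show ?thesis
    unfolding inversions_def by (simp add: card_image inj_on_def)
qed

lemma inversions_single_right: "inversions \<alpha> {i} = card {j \<in> \<alpha>. i < j}"
proof -
  have "{(k, j). k \<in> \<alpha> \<and> j \<in> {i} \<and> j < k} = (\<lambda>k. (k, i)) ` {j \<in> \<alpha>. i < j}"
    by auto
  then show ?thesis
    unfolding inversions_def by (simp add: card_image inj_on_def)
qed

context ring
begin

lemma signed_closed [simp]: "c \<in> carrier R \<Longrightarrow> signed R m c \<in> carrier R"
  by (simp add: signed_def)

lemma signed_zero [simp]: "signed R m \<zero> = \<zero>"
  by (simp add: signed_def)

lemma signed_0 [simp]: "signed R 0 c = c"
  by (simp add: signed_def)

lemma signed_add:
  "\<lbrakk>a \<in> carrier R; b \<in> carrier R\<rbrakk> \<Longrightarrow> signed R m (a \<oplus> b) = signed R m a \<oplus> signed R m b"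
  by (simp add: signed_def minus_add)

lemma signed_mult_left:
  "\<lbrakk>a \<in> carrier R; b \<in> carrier R\<rbrakk> \<Longrightarrow> signed R m a \<otimes> b = signed R m (a \<otimes> b)"
  by (simp add: signed_def l_minus)

lemma signed_mult_right:
  "\<lbrakk>a \<in> carrier R; b \<in> carrier R\<rbrakk> \<Longrightarrow> a \<otimes> signed R m b = signed R m (a \<otimes> b)"
  by (simp add: signed_def r_minus)

lemma signed_signed: "c \<in> carrier R \<Longrightarrow> signed R m (signed R k c) = signed R (m + k) c"
  by (simp add: signed_def)

lemma signed_cong: "even m = even k \<Longrightarrow> signed R m c = signed R k c"
  by (simp add: signed_def)

lemma signed_finsum:
  assumes "f \<in> A \<rightarrow> carrier R"
  shows "signed R m (\<Oplus>i\<in>A. f i) = (\<Oplus>i\<in>A. signed R m (f i))"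
  using assms
proof (induction A rule: infinite_finite_induct)
  case (insert x A)
  then have "f \<in> A \<rightarrow> carrier R" "f x \<in> carrier R"
    by auto
  with insert show ?case
    by (simp add: signed_add Pi_iff)
qed simp_all

lemma finsum_Sigma:
  assumes "finite A" "\<And>x. x \<in> A \<Longrightarrow> finite (B x)"
    and "\<And>x y. x \<in> A \<Longrightarrow> y \<in> B x \<Longrightarrow> f x y \<in> carrier R"
  shows "(\<Oplus>x\<in>A. \<Oplus>y\<in>B x. f x y) = (\<Oplus>p\<in>Sigma A B. f (fst p) (snd p))"
  using assms
proof (induction A)
  case (insert x A)
  have eq: "Sigma (insert x A) B = Pair x ` B x \<union> Sigma A B"
    by auto
  have "(\<Oplus>p\<in>Pair x ` B x. f (fst p) (snd p)) = (\<Oplus>y\<in>B x. f x y)"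
    by (subst finsum_reindex) (use insert in \<open>auto simp: inj_on_def\<close>)
  moreover have "(\<Oplus>p\<in>Pair x ` B x \<union> Sigma A B. f (fst p) (snd p)) =
      (\<Oplus>p\<in>Pair x ` B x. f (fst p) (snd p)) \<oplus> (\<Oplus>p\<in>Sigma A B. f (fst p) (snd p))"
    by (rule finsum_Un_disjoint) (use insert in auto)
  moreover have "(\<Oplus>x\<in>insert x A. \<Oplus>y\<in>B x. f x y) =
      (\<Oplus>y\<in>B x. f x y) \<oplus> (\<Oplus>x\<in>A. \<Oplus>y\<in>B x. f x y)"
    by (rule finsum_insert) (use insert in \<open>auto intro!: finsum_closed\<close>)
  ultimately show ?case
    using insert unfolding eq by simp
qed simp

lemma finsum_delta:
  assumes "finite A" "i \<in> A" "f i \<in> carrier R" "\<And>j. j \<in> A \<Longrightarrow> j \<noteq> i \<Longrightarrow> f j = \<zero>"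
  shows "(\<Oplus>j\<in>A. f j) = f i"
proof -
  have fcl: "f j \<in> carrier R" if "j \<in> A" for j
    using that assms(3) assms(4)[of j] by (cases "j = i") auto
  have "(\<Oplus>j\<in>A. f j) = (\<Oplus>j\<in>A. if i = j then f j else \<zero>)"
    by (rule finsum_cong') (use assms in \<open>auto simp: fcl\<close>)
  also have "\<dots> = f i"
    by (rule finsum_singleton) (use assms fcl in auto)
  finally show ?thesis .
qed

lemma finsum_Pow_insert:
  assumes "finite \<gamma>" "i \<notin> \<gamma>" "\<And>\<alpha>. \<alpha> \<subseteq> insert i \<gamma> \<Longrightarrow> f \<alpha> \<in> carrier R"
  shows "(\<Oplus>\<alpha>\<in>Pow (insert i \<gamma>). f \<alpha>) =
    (\<Oplus>\<alpha>\<in>Pow \<gamma>. f (insert i \<alpha>)) \<oplus> (\<Oplus>\<alpha>\<in>Pow \<gamma>. f \<alpha>)"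
proof -
  have cl: "f \<alpha> \<in> carrier R" "f (insert i \<alpha>) \<in> carrier R" if "\<alpha> \<subseteq> \<gamma>" for \<alpha>
    using that by (auto intro!: assms(3))
  have inj: "inj_on (insert i) (Pow \<gamma>)"
    using assms(2) by (auto simp: inj_on_def insert_eq_iff)
  have "(\<Oplus>\<alpha>\<in>Pow (insert i \<gamma>). f \<alpha>) =
      (\<Oplus>\<alpha>\<in>Pow \<gamma>. f \<alpha>) \<oplus> (\<Oplus>\<alpha>\<in>insert i ` Pow \<gamma>. f \<alpha>)"
    unfolding Pow_insert by (rule finsum_Un_disjoint) (use assms cl in auto)
  also have "(\<Oplus>\<alpha>\<in>insert i ` Pow \<gamma>. f \<alpha>) = (\<Oplus>\<alpha>\<in>Pow \<gamma>. f (insert i \<alpha>))"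
    by (rule finsum_reindex) (use inj cl in auto)
  finally show ?thesis
    using cl by (simp add: a_comm finsum_closed)
qed

end


section \<open>The Grassmann ring is a ring\<close>

lemma gsubset_finite [simp]: "\<gamma> \<subseteq> {1..n::nat} \<Longrightarrow> finite \<gamma>"
  by (rule finite_subset) auto

context ring
begin

lemma gcarrier: "carrier (grassmann R n) = Pow {1..n} \<rightarrow>\<^sub>E carrier R"
  by (simp add: grassmann_def)

lemma gelem_closed [simp]:
  "a \<in> carrier (grassmann R n) \<Longrightarrow> \<gamma> \<subseteq> {1..n} \<Longrightarrow> a \<gamma> \<in> carrier R"
  by (rule PiE_mem[of a "Pow {1..n}" "\<lambda>_. carrier R"]) (simp_all add: gcarrier)

lemma gelem_closed_sub [simp]:
  assumes "a \<in> carrier (grassmann R n)" "\<gamma> \<subseteq> {1..n}"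
  shows "\<alpha> \<subseteq> \<gamma> \<Longrightarrow> a \<alpha> \<in> carrier R" and "a (\<gamma> - \<alpha>) \<in> carrier R"
  by (rule gelem_closed[OF assms(1)], use assms(2) in blast)+

lemma gelem_eqI:
  assumes "a \<in> carrier (grassmann R n)" "b \<in> carrier (grassmann R n)"
    and "\<And>\<gamma>. \<gamma> \<subseteq> {1..n} \<Longrightarrow> a \<gamma> = b \<gamma>"
  shows "a = b"
  by (rule PiE_ext[OF assms(1,2)[unfolded gcarrier]]) (simp add: assms(3))

lemma gmult_apply:
  "\<gamma> \<subseteq> {1..n} \<Longrightarrow> (a \<otimes>\<^bsub>grassmann R n\<^esub> b) \<gamma> =
    (\<Oplus>\<alpha>\<in>Pow \<gamma>. signed R (inversions \<alpha> (\<gamma> - \<alpha>)) (a \<alpha> \<otimes> b (\<gamma> - \<alpha>)))"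
  by (simp add: grassmann_def)

lemma gadd_apply: "\<gamma> \<subseteq> {1..n} \<Longrightarrow> (a \<oplus>\<^bsub>grassmann R n\<^esub> b) \<gamma> = a \<gamma> \<oplus> b \<gamma>"
  by (simp add: grassmann_def)

lemma gone_apply:
  "\<gamma> \<subseteq> {1..n} \<Longrightarrow> \<one>\<^bsub>grassmann R n\<^esub> \<gamma> = (if \<gamma> = {} then \<one> else \<zero>)"
  by (simp add: grassmann_def)

lemma gzero_apply: "\<gamma> \<subseteq> {1..n} \<Longrightarrow> \<zero>\<^bsub>grassmann R n\<^esub> \<gamma> = \<zero>"
  by (simp add: grassmann_def)

lemma gmonom_apply:
  "\<gamma> \<subseteq> {1..n} \<Longrightarrow> gmonom R n \<alpha> c \<gamma> = (if \<gamma> = \<alpha> then c else \<zero>)"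
  by (simp add: gmonom_def)

lemma gmult_closed [simp]:
  assumes "a \<in> carrier (grassmann R n)" "b \<in> carrier (grassmann R n)"
  shows "a \<otimes>\<^bsub>grassmann R n\<^esub> b \<in> carrier (grassmann R n)"
  using assms by (auto simp: grassmann_def intro!: finsum_closed signed_closed m_closed)

lemma gadd_closed [simp]:
  assumes "a \<in> carrier (grassmann R n)" "b \<in> carrier (grassmann R n)"
  shows "a \<oplus>\<^bsub>grassmann R n\<^esub> b \<in> carrier (grassmann R n)"
  using assms by (auto simp: grassmann_def)

lemma gone_closed [simp]: "\<one>\<^bsub>grassmann R n\<^esub> \<in> carrier (grassmann R n)"
  by (auto simp: grassmann_def)

lemma gzero_closed [simp]: "\<zero>\<^bsub>grassmann R n\<^esub> \<in> carrier (grassmann R n)"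
  by (auto simp: grassmann_def)

lemma gmonom_closed [simp]: "c \<in> carrier R \<Longrightarrow> gmonom R n \<alpha> c \<in> carrier (grassmann R n)"
  by (auto simp: grassmann_def gmonom_def)

lemma gconst_closed [simp]: "c \<in> carrier R \<Longrightarrow> gconst R n c \<in> carrier (grassmann R n)"
  by (simp add: gconst_def)

lemma gvar_closed [simp]: "gvar R n i \<in> carrier (grassmann R n)"
  by (simp add: gvar_def)

lemma gmult_assoc:
  assumes a: "a \<in> carrier (grassmann R n)" and b: "b \<in> carrier (grassmann R n)"
    and c: "c \<in> carrier (grassmann R n)"
  shows "(a \<otimes>\<^bsub>grassmann R n\<^esub> b) \<otimes>\<^bsub>grassmann R n\<^esub> c =
    a \<otimes>\<^bsub>grassmann R n\<^esub> (b \<otimes>\<^bsub>grassmann R n\<^esub> c)"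
proof (rule gelem_eqI)
  fix \<gamma> :: "nat set"
  assume \<gamma>: "\<gamma> \<subseteq> {1..n}"
  define F where "F \<alpha> \<beta> \<delta> =
      signed R (inversions \<alpha> \<delta> + inversions \<beta> \<delta> + inversions \<alpha> \<beta>) (a \<alpha> \<otimes> (b \<beta> \<otimes> c \<delta>))"
    for \<alpha> \<beta> \<delta>
  have F: "F \<alpha> \<beta> \<delta> \<in> carrier R" if "\<alpha> \<subseteq> \<gamma>" "\<beta> \<subseteq> \<gamma>" "\<delta> \<subseteq> \<gamma>" for \<alpha> \<beta> \<delta>
    using that a b c \<gamma> by (simp add: F_def)
  have "((a \<otimes>\<^bsub>grassmann R n\<^esub> b) \<otimes>\<^bsub>grassmann R n\<^esub> c) \<gamma> =
      (\<Oplus>\<delta>\<in>Pow \<gamma>. \<Oplus>\<alpha>\<in>Pow \<delta>. F \<alpha> (\<delta> - \<alpha>) (\<gamma> - \<delta>))"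
    unfolding gmult_apply[OF \<gamma>]
  proof (rule finsum_cong', simp)
    show "(\<lambda>\<delta>. \<Oplus>\<alpha>\<in>Pow \<delta>. F \<alpha> (\<delta> - \<alpha>) (\<gamma> - \<delta>)) \<in> Pow \<gamma> \<rightarrow> carrier R"
      by (auto intro!: finsum_closed F)
    fix \<delta>
    assume "\<delta> \<in> Pow \<gamma>"
    then have \<delta>: "\<delta> \<subseteq> \<gamma>" "\<delta> \<subseteq> {1..n}"
      using \<gamma> by auto
    have fin: "finite \<gamma>" "finite \<delta>"
      using \<gamma> \<delta> by auto
    let ?g = "\<lambda>\<alpha>. signed R (inversions \<alpha> (\<delta> - \<alpha>)) (a \<alpha> \<otimes> b (\<delta> - \<alpha>))"
    have g: "?g \<alpha> \<in> carrier R" if "\<alpha> \<subseteq> \<delta>" for \<alpha>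
      using that a b \<delta> by simp
    have cd: "c (\<gamma> - \<delta>) \<in> carrier R"
      using c \<gamma> by simp
    have "signed R (inversions \<delta> (\<gamma> - \<delta>)) ((a \<otimes>\<^bsub>grassmann R n\<^esub> b) \<delta> \<otimes> c (\<gamma> - \<delta>)) =
        signed R (inversions \<delta> (\<gamma> - \<delta>)) (\<Oplus>\<alpha>\<in>Pow \<delta>. ?g \<alpha> \<otimes> c (\<gamma> - \<delta>))"
      unfolding gmult_apply[OF \<delta>(2)] by (subst finsum_ldistr) (use fin g cd in auto)
    also have "\<dots> = (\<Oplus>\<alpha>\<in>Pow \<delta>. signed R (inversions \<delta> (\<gamma> - \<delta>)) (?g \<alpha> \<otimes> c (\<gamma> - \<delta>)))"
      by (rule signed_finsum) (use g cd in auto)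
    also have "\<dots> = (\<Oplus>\<alpha>\<in>Pow \<delta>. F \<alpha> (\<delta> - \<alpha>) (\<gamma> - \<delta>))"
    proof (rule finsum_cong', simp)
      show "(\<lambda>\<alpha>. F \<alpha> (\<delta> - \<alpha>) (\<gamma> - \<delta>)) \<in> Pow \<delta> \<rightarrow> carrier R"
        using \<delta> by (auto intro!: F)
      fix \<alpha>
      assume "\<alpha> \<in> Pow \<delta>"
      then have \<alpha>: "\<alpha> \<subseteq> \<delta>" "finite \<alpha>" and cl: "a \<alpha> \<in> carrier R" "b (\<delta> - \<alpha>) \<in> carrier R"
        using a b \<delta> fin by (auto intro: finite_subset)
      have "inversions \<delta> (\<gamma> - \<delta>) = inversions \<alpha> (\<gamma> - \<delta>) + inversions (\<delta> - \<alpha>) (\<gamma> - \<delta>)"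
        using inversions_Un_left[of \<alpha> "\<delta> - \<alpha>" "\<gamma> - \<delta>"] \<alpha> fin by (simp add: Un_absorb1)
      then show "signed R (inversions \<delta> (\<gamma> - \<delta>)) (?g \<alpha> \<otimes> c (\<gamma> - \<delta>)) = F \<alpha> (\<delta> - \<alpha>) (\<gamma> - \<delta>)"
        using cl cd by (simp add: F_def signed_mult_left signed_signed m_assoc)
    qed
    finally show "signed R (inversions \<delta> (\<gamma> - \<delta>)) ((a \<otimes>\<^bsub>grassmann R n\<^esub> b) \<delta> \<otimes> c (\<gamma> - \<delta>)) =
        (\<Oplus>\<alpha>\<in>Pow \<delta>. F \<alpha> (\<delta> - \<alpha>) (\<gamma> - \<delta>))" .
  qed
  also have "\<dots> = (\<Oplus>p\<in>Sigma (Pow \<gamma>) Pow. F (snd p) (fst p - snd p) (\<gamma> - fst p))"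
    by (rule finsum_Sigma) (use \<gamma> in \<open>auto intro!: F intro: finite_subset\<close>)
  also have "\<dots> = (\<Oplus>q\<in>Sigma (Pow \<gamma>) (\<lambda>\<alpha>. Pow (\<gamma> - \<alpha>)). F (fst q) (snd q) (\<gamma> - fst q - snd q))"
  proof -
    let ?S = "Sigma (Pow \<gamma>) (\<lambda>\<alpha>. Pow (\<gamma> - \<alpha>))"
    let ?h = "\<lambda>q. (fst q \<union> snd q, fst q :: nat set)"
    have im: "Sigma (Pow \<gamma>) Pow = ?h ` ?S"
    proof (intro equalityI subsetI)
      fix p
      assume "p \<in> Sigma (Pow \<gamma>) Pow"
      then have "(snd p, fst p - snd p) \<in> ?S" "p = ?h (snd p, fst p - snd p)"
        by (auto simp: prod_eq_iff)
      then show "p \<in> ?h ` ?S"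
        by (rule image_eqI[rotated])
    qed auto
    have "inj_on ?h ?S"
      by (auto simp: inj_on_def)
    then have "(\<Oplus>p\<in>?h ` ?S. F (snd p) (fst p - snd p) (\<gamma> - fst p)) =
        (\<Oplus>q\<in>?S. F (snd (?h q)) (fst (?h q) - snd (?h q)) (\<gamma> - fst (?h q)))"
      by (intro finsum_reindex) (auto intro!: F)
    also have "\<dots> = (\<Oplus>q\<in>?S. F (fst q) (snd q) (\<gamma> - fst q - snd q))"
    proof (rule finsum_cong', simp)
      fix q
      assume "q \<in> ?S"
      then have "fst q \<union> snd q - fst q = snd q" "\<gamma> - (fst q \<union> snd q) = \<gamma> - fst q - snd q"
        by auto
      then show "F (snd (?h q)) (fst (?h q) - snd (?h q)) (\<gamma> - fst (?h q)) =
          F (fst q) (snd q) (\<gamma> - fst q - snd q)"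
        by simp
    qed (auto intro!: F)
    finally show ?thesis
      unfolding im .
  qed
  also have "\<dots> = (\<Oplus>\<alpha>\<in>Pow \<gamma>. \<Oplus>\<beta>\<in>Pow (\<gamma> - \<alpha>). F \<alpha> \<beta> (\<gamma> - \<alpha> - \<beta>))"
    by (rule finsum_Sigma[symmetric]) (use \<gamma> in \<open>auto intro!: F intro: finite_subset\<close>)
  also have "\<dots> = (a \<otimes>\<^bsub>grassmann R n\<^esub> (b \<otimes>\<^bsub>grassmann R n\<^esub> c)) \<gamma>"
    unfolding gmult_apply[OF \<gamma>]
  proof (rule finsum_cong', simp)
    show "(\<lambda>\<alpha>. signed R (inversions \<alpha> (\<gamma> - \<alpha>))
        (a \<alpha> \<otimes> (b \<otimes>\<^bsub>grassmann R n\<^esub> c) (\<gamma> - \<alpha>))) \<in> Pow \<gamma> \<rightarrow> carrier R"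
      using gelem_closed_sub(1)[OF a \<gamma>] gelem_closed_sub(2)[OF gmult_closed[OF b c] \<gamma>]
      by (auto intro!: signed_closed m_closed)
    fix \<alpha>
    assume "\<alpha> \<in> Pow \<gamma>"
    then have \<alpha>: "\<alpha> \<subseteq> \<gamma>" "\<gamma> - \<alpha> \<subseteq> {1..n}" and fin: "finite \<alpha>" "finite (\<gamma> - \<alpha>)"
      using \<gamma> by (auto intro: finite_subset)
    let ?g = "\<lambda>\<beta>. signed R (inversions \<beta> (\<gamma> - \<alpha> - \<beta>)) (b \<beta> \<otimes> c (\<gamma> - \<alpha> - \<beta>))"
    have g: "?g \<beta> \<in> carrier R" if "\<beta> \<subseteq> \<gamma> - \<alpha>" for \<beta>
      using that b c \<alpha>(2) by (auto intro!: signed_closed m_closed intro: gelem_closed_sub)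
    have ca: "a \<alpha> \<in> carrier R"
      using a \<alpha> \<gamma> by simp
    have "signed R (inversions \<alpha> (\<gamma> - \<alpha>)) (a \<alpha> \<otimes> (b \<otimes>\<^bsub>grassmann R n\<^esub> c) (\<gamma> - \<alpha>)) =
        signed R (inversions \<alpha> (\<gamma> - \<alpha>)) (\<Oplus>\<beta>\<in>Pow (\<gamma> - \<alpha>). a \<alpha> \<otimes> ?g \<beta>)"
      unfolding gmult_apply[OF \<alpha>(2)] by (subst finsum_rdistr) (use fin g ca in auto)
    also have "\<dots> = (\<Oplus>\<beta>\<in>Pow (\<gamma> - \<alpha>). signed R (inversions \<alpha> (\<gamma> - \<alpha>)) (a \<alpha> \<otimes> ?g \<beta>))"
      by (rule signed_finsum) (use g ca in auto)
    also have "\<dots> = (\<Oplus>\<beta>\<in>Pow (\<gamma> - \<alpha>). F \<alpha> \<beta> (\<gamma> - \<alpha> - \<beta>))"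
    proof (rule finsum_cong', simp)
      show "(\<lambda>\<beta>. F \<alpha> \<beta> (\<gamma> - \<alpha> - \<beta>)) \<in> Pow (\<gamma> - \<alpha>) \<rightarrow> carrier R"
        using \<alpha> by (auto intro!: F)
      fix \<beta>
      assume "\<beta> \<in> Pow (\<gamma> - \<alpha>)"
      then have \<beta>: "\<beta> \<subseteq> \<gamma> - \<alpha>" "finite \<beta>"
        and cl: "b \<beta> \<in> carrier R" "c (\<gamma> - \<alpha> - \<beta>) \<in> carrier R"
        using b c \<alpha> fin by (auto intro: finite_subset gelem_closed_sub)
      have "inversions \<alpha> (\<gamma> - \<alpha>) = inversions \<alpha> \<beta> + inversions \<alpha> (\<gamma> - \<alpha> - \<beta>)"
        using inversions_Un_right[of \<beta> "\<gamma> - \<alpha> - \<beta>" \<alpha>] \<beta> fin by (simp add: Un_absorb1)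
      then show "signed R (inversions \<alpha> (\<gamma> - \<alpha>)) (a \<alpha> \<otimes> ?g \<beta>) = F \<alpha> \<beta> (\<gamma> - \<alpha> - \<beta>)"
        using cl ca by (simp add: F_def signed_mult_right signed_signed add_ac)
    qed
    finally show "(\<Oplus>\<beta>\<in>Pow (\<gamma> - \<alpha>). F \<alpha> \<beta> (\<gamma> - \<alpha> - \<beta>)) =
        signed R (inversions \<alpha> (\<gamma> - \<alpha>)) (a \<alpha> \<otimes> (b \<otimes>\<^bsub>grassmann R n\<^esub> c) (\<gamma> - \<alpha>))"
      by simp
  qed
  finally show "((a \<otimes>\<^bsub>grassmann R n\<^esub> b) \<otimes>\<^bsub>grassmann R n\<^esub> c) \<gamma> =
      (a \<otimes>\<^bsub>grassmann R n\<^esub> (b \<otimes>\<^bsub>grassmann R n\<^esub> c)) \<gamma>" .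
qed (use a b c in simp_all)

lemma gmonom_mult_apply:
  assumes "c \<in> carrier R" "a \<in> carrier (grassmann R n)" "\<gamma> \<subseteq> {1..n}"
  shows "(gmonom R n \<alpha> c \<otimes>\<^bsub>grassmann R n\<^esub> a) \<gamma> =
    (if \<alpha> \<subseteq> \<gamma> then signed R (inversions \<alpha> (\<gamma> - \<alpha>)) (c \<otimes> a (\<gamma> - \<alpha>)) else \<zero>)"
proof (cases "\<alpha> \<subseteq> \<gamma>")
  case True
  then have "(gmonom R n \<alpha> c \<otimes>\<^bsub>grassmann R n\<^esub> a) \<gamma> = signed R (inversions \<alpha> (\<gamma> - \<alpha>))
      (gmonom R n \<alpha> c \<alpha> \<otimes> a (\<gamma> - \<alpha>))"
    unfolding gmult_apply[OF assms(3)]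
    by (intro finsum_delta) (use assms in \<open>auto simp: gmonom_apply\<close>)
  then show ?thesis
    using True assms by (simp add: gmonom_apply)
next
  case False
  have "(gmonom R n \<alpha> c \<otimes>\<^bsub>grassmann R n\<^esub> a) \<gamma> = (\<Oplus>\<beta>\<in>Pow \<gamma>. \<zero>)"
    unfolding gmult_apply[OF assms(3)]
    by (intro finsum_cong') (use assms False in \<open>auto simp: gmonom_apply\<close>)
  then show ?thesis
    using False by simp
qed

lemma mult_gmonom_apply:
  assumes "c \<in> carrier R" "a \<in> carrier (grassmann R n)" "\<gamma> \<subseteq> {1..n}"
  shows "(a \<otimes>\<^bsub>grassmann R n\<^esub> gmonom R n \<alpha> c) \<gamma> =
    (if \<alpha> \<subseteq> \<gamma> then signed R (inversions (\<gamma> - \<alpha>) \<alpha>) (a (\<gamma> - \<alpha>) \<otimes> c) else \<zero>)"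
proof (cases "\<alpha> \<subseteq> \<gamma>")
  case True
  then have dd: "\<gamma> - (\<gamma> - \<alpha>) = \<alpha>"
    by auto
  have "(a \<otimes>\<^bsub>grassmann R n\<^esub> gmonom R n \<alpha> c) \<gamma> =
      signed R (inversions (\<gamma> - \<alpha>) (\<gamma> - (\<gamma> - \<alpha>)))
        (a (\<gamma> - \<alpha>) \<otimes> gmonom R n \<alpha> c (\<gamma> - (\<gamma> - \<alpha>)))"
    unfolding gmult_apply[OF assms(3)]
  proof (rule finsum_delta)
    fix \<beta>
    assume "\<beta> \<in> Pow \<gamma>" "\<beta> \<noteq> \<gamma> - \<alpha>"
    then have "\<gamma> - \<beta> \<noteq> \<alpha>" "\<gamma> - \<beta> \<subseteq> {1..n}" "a \<beta> \<in> carrier R"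
      using assms by auto
    then show "signed R (inversions \<beta> (\<gamma> - \<beta>)) (a \<beta> \<otimes> gmonom R n \<alpha> c (\<gamma> - \<beta>)) = \<zero>"
      by (simp add: gmonom_apply)
  qed (use assms True in \<open>auto simp: dd gmonom_apply[OF subset_trans]\<close>)
  then show ?thesis
    using True assms by (simp add: gmonom_apply dd)
next
  case False
  have "(a \<otimes>\<^bsub>grassmann R n\<^esub> gmonom R n \<alpha> c) \<gamma> = (\<Oplus>\<beta>\<in>Pow \<gamma>. \<zero>)"
    unfolding gmult_apply[OF assms(3)]
  proof (rule finsum_cong', simp)
    fix \<beta>
    assume "\<beta> \<in> Pow \<gamma>"
    then have "\<gamma> - \<beta> \<noteq> \<alpha>" "\<gamma> - \<beta> \<subseteq> {1..n}" "a \<beta> \<in> carrier R"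
      using assms False by auto
    then show "signed R (inversions \<beta> (\<gamma> - \<beta>)) (a \<beta> \<otimes> gmonom R n \<alpha> c (\<gamma> - \<beta>)) = \<zero>"
      by (simp add: gmonom_apply)
  qed simp
  then show ?thesis
    using False by simp
qed

lemma gone_eq: "\<one>\<^bsub>grassmann R n\<^esub> = gmonom R n {} \<one>"
  by (auto simp: grassmann_def gmonom_def)

theorem grassmann_ring: "ring (grassmann R n)"
proof (rule ringI)
  let ?L = "grassmann R n"
  show "abelian_group ?L"
  proof (rule abelian_groupI)
    fix a
    assume a: "a \<in> carrier ?L"
    define b where "b = (\<lambda>\<gamma>\<in>Pow {1..n}. \<ominus> a \<gamma>)"
    have b: "b \<in> carrier ?L"
      using a by (auto simp: b_def grassmann_def)
    have "b \<oplus>\<^bsub>?L\<^esub> a = \<zero>\<^bsub>?L\<^esub>"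
    proof (rule gelem_eqI[of _ n])
      show "(b \<oplus>\<^bsub>?L\<^esub> a) \<gamma> = \<zero>\<^bsub>?L\<^esub> \<gamma>" if "\<gamma> \<subseteq> {1..n}" for \<gamma>
        using that a by (simp add: gadd_apply gzero_apply b_def l_neg)
    qed (use a b in simp_all)
    with b show "\<exists>b\<in>carrier ?L. b \<oplus>\<^bsub>?L\<^esub> a = \<zero>\<^bsub>?L\<^esub>"
      by blast
  qed (auto intro!: gelem_eqI[of _ n] simp: gadd_apply gzero_apply a_ac)
  show "Group.monoid ?L"
  proof (rule monoidI)
    fix a
    assume a: "a \<in> carrier ?L"
    show "\<one>\<^bsub>?L\<^esub> \<otimes>\<^bsub>?L\<^esub> a = a"
      unfolding gone_eq by (rule gelem_eqI) (use a in \<open>auto simp: gmonom_mult_apply\<close>)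
    show "a \<otimes>\<^bsub>?L\<^esub> \<one>\<^bsub>?L\<^esub> = a"
      unfolding gone_eq by (rule gelem_eqI) (use a in \<open>auto simp: mult_gmonom_apply\<close>)
  qed (auto simp: gmult_assoc)
  fix a b c
  assume abc: "a \<in> carrier ?L" "b \<in> carrier ?L" "c \<in> carrier ?L"
  show "(a \<oplus>\<^bsub>?L\<^esub> b) \<otimes>\<^bsub>?L\<^esub> c = a \<otimes>\<^bsub>?L\<^esub> c \<oplus>\<^bsub>?L\<^esub> b \<otimes>\<^bsub>?L\<^esub> c"
  proof (rule gelem_eqI[of _ n])
    fix \<gamma> :: "nat set"
    assume \<gamma>: "\<gamma> \<subseteq> {1..n}"
    let ?f = "\<lambda>\<alpha>. signed R (inversions \<alpha> (\<gamma> - \<alpha>)) (a \<alpha> \<otimes> c (\<gamma> - \<alpha>))"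
    let ?g = "\<lambda>\<alpha>. signed R (inversions \<alpha> (\<gamma> - \<alpha>)) (b \<alpha> \<otimes> c (\<gamma> - \<alpha>))"
    have cl: "a \<alpha> \<in> carrier R" "b \<alpha> \<in> carrier R" "c \<alpha> \<in> carrier R" "a (\<gamma> - \<alpha>) \<in> carrier R"
        "b (\<gamma> - \<alpha>) \<in> carrier R" "c (\<gamma> - \<alpha>) \<in> carrier R" if "\<alpha> \<in> Pow \<gamma>" for \<alpha>
      using abc[THEN gelem_closed_sub(1), OF \<gamma>, of \<alpha>] abc[THEN gelem_closed_sub(2), OF \<gamma>, of \<alpha>] that
      by simp_all
    have fg: "?f \<in> Pow \<gamma> \<rightarrow> carrier R" "?g \<in> Pow \<gamma> \<rightarrow> carrier R"
      using cl by simp_all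
    have "((a \<oplus>\<^bsub>?L\<^esub> b) \<otimes>\<^bsub>?L\<^esub> c) \<gamma> = (\<Oplus>\<alpha>\<in>Pow \<gamma>. ?f \<alpha> \<oplus> ?g \<alpha>)"
      unfolding gmult_apply[OF \<gamma>]
    proof (rule finsum_cong', simp)
      show "(\<lambda>\<alpha>. ?f \<alpha> \<oplus> ?g \<alpha>) \<in> Pow \<gamma> \<rightarrow> carrier R"
        using cl by simp
      fix \<alpha>
      assume \<alpha>: "\<alpha> \<in> Pow \<gamma>"
      then have "\<alpha> \<subseteq> {1..n}" "\<gamma> - \<alpha> \<subseteq> {1..n}"
        using \<gamma> by auto
      then show "signed R (inversions \<alpha> (\<gamma> - \<alpha>)) ((a \<oplus>\<^bsub>?L\<^esub> b) \<alpha> \<otimes> c (\<gamma> - \<alpha>)) = ?f \<alpha> \<oplus> ?g \<alpha>"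
        using cl[OF \<alpha>] by (simp add: gadd_apply l_distr signed_add)
    qed
    also have "\<dots> = (a \<otimes>\<^bsub>?L\<^esub> c \<oplus>\<^bsub>?L\<^esub> b \<otimes>\<^bsub>?L\<^esub> c) \<gamma>"
      unfolding finsum_addf[OF fg] gadd_apply[OF \<gamma>] gmult_apply[OF \<gamma>] ..
    finally show "((a \<oplus>\<^bsub>?L\<^esub> b) \<otimes>\<^bsub>?L\<^esub> c) \<gamma> = (a \<otimes>\<^bsub>?L\<^esub> c \<oplus>\<^bsub>?L\<^esub> b \<otimes>\<^bsub>?L\<^esub> c) \<gamma>" .
  qed (use abc in simp_all)
  show "c \<otimes>\<^bsub>?L\<^esub> (a \<oplus>\<^bsub>?L\<^esub> b) = c \<otimes>\<^bsub>?L\<^esub> a \<oplus>\<^bsub>?L\<^esub> c \<otimes>\<^bsub>?L\<^esub> b"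
  proof (rule gelem_eqI[of _ n])
    fix \<gamma> :: "nat set"
    assume \<gamma>: "\<gamma> \<subseteq> {1..n}"
    let ?f = "\<lambda>\<alpha>. signed R (inversions \<alpha> (\<gamma> - \<alpha>)) (c \<alpha> \<otimes> a (\<gamma> - \<alpha>))"
    let ?g = "\<lambda>\<alpha>. signed R (inversions \<alpha> (\<gamma> - \<alpha>)) (c \<alpha> \<otimes> b (\<gamma> - \<alpha>))"
    have cl: "a \<alpha> \<in> carrier R" "b \<alpha> \<in> carrier R" "c \<alpha> \<in> carrier R" "a (\<gamma> - \<alpha>) \<in> carrier R"
        "b (\<gamma> - \<alpha>) \<in> carrier R" "c (\<gamma> - \<alpha>) \<in> carrier R" if "\<alpha> \<in> Pow \<gamma>" for \<alpha>
      using abc[THEN gelem_closed_sub(1), OF \<gamma>, of \<alpha>] abc[THEN gelem_closed_sub(2), OF \<gamma>, of \<alpha>] that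
      by simp_all
    have fg: "?f \<in> Pow \<gamma> \<rightarrow> carrier R" "?g \<in> Pow \<gamma> \<rightarrow> carrier R"
      using cl by simp_all
    have "(c \<otimes>\<^bsub>?L\<^esub> (a \<oplus>\<^bsub>?L\<^esub> b)) \<gamma> = (\<Oplus>\<alpha>\<in>Pow \<gamma>. ?f \<alpha> \<oplus> ?g \<alpha>)"
      unfolding gmult_apply[OF \<gamma>]
    proof (rule finsum_cong', simp)
      show "(\<lambda>\<alpha>. ?f \<alpha> \<oplus> ?g \<alpha>) \<in> Pow \<gamma> \<rightarrow> carrier R"
        using cl by simp
      fix \<alpha>
      assume \<alpha>: "\<alpha> \<in> Pow \<gamma>"
      then have "\<alpha> \<subseteq> {1..n}" "\<gamma> - \<alpha> \<subseteq> {1..n}"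
        using \<gamma> by auto
      then show "signed R (inversions \<alpha> (\<gamma> - \<alpha>)) (c \<alpha> \<otimes> (a \<oplus>\<^bsub>?L\<^esub> b) (\<gamma> - \<alpha>)) = ?f \<alpha> \<oplus> ?g \<alpha>"
        using cl[OF \<alpha>] by (simp add: gadd_apply r_distr signed_add)
    qed
    also have "\<dots> = (c \<otimes>\<^bsub>?L\<^esub> a \<oplus>\<^bsub>?L\<^esub> c \<otimes>\<^bsub>?L\<^esub> b) \<gamma>"
      unfolding finsum_addf[OF fg] gadd_apply[OF \<gamma>] gmult_apply[OF \<gamma>] ..
    finally show "(c \<otimes>\<^bsub>?L\<^esub> (a \<oplus>\<^bsub>?L\<^esub> b)) \<gamma> = (c \<otimes>\<^bsub>?L\<^esub> a \<oplus>\<^bsub>?L\<^esub> c \<otimes>\<^bsub>?L\<^esub> b) \<gamma>" .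
  qed (use abc in simp_all)
qed

interpretation Gr: ring "grassmann R n" for n
  by (rule grassmann_ring)

lemma gminus_apply:
  assumes "a \<in> carrier (grassmann R n)" "\<gamma> \<subseteq> {1..n}"
  shows "(\<ominus>\<^bsub>grassmann R n\<^esub> a) \<gamma> = \<ominus> a \<gamma>"
proof -
  have "(\<ominus>\<^bsub>grassmann R n\<^esub> a \<oplus>\<^bsub>grassmann R n\<^esub> a) \<gamma> = \<zero>"
    using assms by (simp add: Gr.l_neg gzero_apply)
  then have "(\<ominus>\<^bsub>grassmann R n\<^esub> a) \<gamma> \<oplus> a \<gamma> = \<zero>"
    using assms(2) by (simp add: gadd_apply)
  then show ?thesis
    using assms by (metis Gr.a_inv_closed gelem_closed minus_equality)
qed

lemma gsign_mult_apply:
  assumes "a \<in> carrier (grassmann R n)" "\<gamma> \<subseteq> {1..n}"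
  shows "((\<ominus>\<^bsub>grassmann R n\<^esub> \<one>\<^bsub>grassmann R n\<^esub>) [^]\<^bsub>grassmann R n\<^esub> d \<otimes>\<^bsub>grassmann R n\<^esub> a) \<gamma> =
    signed R d (a \<gamma>)"
proof -
  let ?L = "grassmann R n"
  have "(\<ominus>\<^bsub>?L\<^esub> \<one>\<^bsub>?L\<^esub>) [^]\<^bsub>?L\<^esub> d = (if even d then \<one>\<^bsub>?L\<^esub> else \<ominus>\<^bsub>?L\<^esub> \<one>\<^bsub>?L\<^esub>)" for d :: nat
    by (induction d) (simp_all add: Gr.r_minus)
  then show ?thesis
    using assms by (simp add: signed_def Gr.l_minus gminus_apply)
qed


section \<open>Generators, relations and the monomial basis\<close>

lemma gconst_ring_hom: "gconst R n \<in> ring_hom R (grassmann R n)"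
  unfolding ring_hom_def
  by (auto intro!: gelem_eqI[of _ n]
      simp: gconst_def gmonom_mult_apply gmonom_apply gadd_apply gone_eq)

lemma gconst_mult_apply:
  "\<lbrakk>c \<in> carrier R; a \<in> carrier (grassmann R n); \<gamma> \<subseteq> {1..n}\<rbrakk> \<Longrightarrow>
    (gconst R n c \<otimes>\<^bsub>grassmann R n\<^esub> a) \<gamma> = c \<otimes> a \<gamma>"
  by (simp add: gconst_def gmonom_mult_apply)

lemma gvar_mult_apply:
  assumes "a \<in> carrier (grassmann R n)" "\<gamma> \<subseteq> {1..n}"
  shows "(gvar R n i \<otimes>\<^bsub>grassmann R n\<^esub> a) \<gamma> =
    (if i \<in> \<gamma> then signed R (card {j \<in> \<gamma>. j < i}) (a (\<gamma> - {i})) else \<zero>)"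
proof -
  have "{j \<in> \<gamma> - {i}. j < i} = {j \<in> \<gamma>. j < i}"
    by auto
  then show ?thesis
    using assms by (simp add: gvar_def gmonom_mult_apply inversions_single_left)
qed

lemma gvar_square: "gvar R n i \<otimes>\<^bsub>grassmann R n\<^esub> gvar R n i = \<zero>\<^bsub>grassmann R n\<^esub>"
proof (rule gelem_eqI[of _ n])
  fix \<gamma> :: "nat set"
  assume \<gamma>: "\<gamma> \<subseteq> {1..n}"
  then have "\<gamma> - {i} \<subseteq> {1..n}" "\<gamma> - {i} \<noteq> {i}"
    by auto
  with \<gamma> show "(gvar R n i \<otimes>\<^bsub>grassmann R n\<^esub> gvar R n i) \<gamma> = \<zero>\<^bsub>grassmann R n\<^esub> \<gamma>"
    by (simp add: gvar_mult_apply gzero_apply) (simp add: gvar_def gmonom_apply)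
qed simp_all

lemma gvar_anticommute:
  assumes "i \<noteq> j"
  shows "gvar R n i \<otimes>\<^bsub>grassmann R n\<^esub> gvar R n j =
    \<ominus>\<^bsub>grassmann R n\<^esub> (gvar R n j \<otimes>\<^bsub>grassmann R n\<^esub> gvar R n i)"
proof (rule gelem_eqI[of _ n])
  have val: "(gvar R n k \<otimes>\<^bsub>grassmann R n\<^esub> gvar R n l) \<gamma> =
      (if \<gamma> = {k, l} then if k < l then \<one> else \<ominus> \<one> else \<zero>)"
    if "\<gamma> \<subseteq> {1..n}" "k \<noteq> l" for \<gamma> k l
  proof -
    have sub: "\<gamma> - {k} \<subseteq> {1..n}"
      using that by auto
    have iff: "k \<in> \<gamma> \<and> \<gamma> - {k} = {l} \<longleftrightarrow> \<gamma> = {k, l}"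
      using that by auto
    have "card {m \<in> {k, l}. m < k} = (if k < l then 0 else 1)"
    proof (cases "k < l")
      case False
      then have "{m \<in> {k, l}. m < k} = {l}"
        using that by auto
      then show ?thesis
        using False by simp
    next
      case True
      then have "{m \<in> {k, l}. m < k} = {}"
        by auto
      then show ?thesis
        using True by (simp only: card.empty if_True)
    qed
    moreover have "(gvar R n k \<otimes>\<^bsub>grassmann R n\<^esub> gvar R n l) \<gamma> =
        (if k \<in> \<gamma> then signed R (card {m \<in> \<gamma>. m < k}) (if \<gamma> - {k} = {l} then \<one> else \<zero>) else \<zero>)"
      unfolding gvar_mult_apply[OF gvar_closed that(1)]
      unfolding gvar_def gmonom_apply[OF sub] ..
    ultimately show ?thesis
      using iff by (cases "\<gamma> = {k, l}") (simp_all only: signed_def, auto)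
  qed
  fix \<gamma> :: "nat set"
  assume "\<gamma> \<subseteq> {1..n}"
  then show "(gvar R n i \<otimes>\<^bsub>grassmann R n\<^esub> gvar R n j) \<gamma> =
      (\<ominus>\<^bsub>grassmann R n\<^esub> (gvar R n j \<otimes>\<^bsub>grassmann R n\<^esub> gvar R n i)) \<gamma>"
    using assms by (auto simp: gminus_apply val insert_commute)
qed simp_all

lemma gvar_mult_gmonom:
  assumes "\<And>k. k \<in> \<alpha> \<Longrightarrow> j < k" "c \<in> carrier R"
  shows "gvar R n j \<otimes>\<^bsub>grassmann R n\<^esub> gmonom R n \<alpha> c = gmonom R n (insert j \<alpha>) c"
proof (rule gelem_eqI[of _ n])
  fix \<gamma> :: "nat set"
  assume \<gamma>: "\<gamma> \<subseteq> {1..n}"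
  then have sub: "\<gamma> - {j} \<subseteq> {1..n}"
    by auto
  have iff: "j \<in> \<gamma> \<and> \<gamma> - {j} = \<alpha> \<longleftrightarrow> \<gamma> = insert j \<alpha>"
    using assms(1) by auto
  have "{k \<in> insert j \<alpha>. k < j} = {}"
    using assms(1) by (auto dest: order.asym)
  then have card: "card {k \<in> insert j \<alpha>. k < j} = 0"
    by (simp only: card.empty)
  show "(gvar R n j \<otimes>\<^bsub>grassmann R n\<^esub> gmonom R n \<alpha> c) \<gamma> = gmonom R n (insert j \<alpha>) c \<gamma>"
  proof (cases "\<gamma> = insert j \<alpha>")
    case True
    then show ?thesis
      using \<gamma> sub iff card assms(2)
      by (simp only: gvar_mult_apply[OF gmonom_closed] gmonom_apply signed_0 if_True simp_thms)
  next
    case False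
    then show ?thesis
      using \<gamma> sub iff assms(2) by (auto simp: gvar_mult_apply gmonom_apply)
  qed
qed (use assms in simp_all)

lemma gvar_gconst_commute:
  assumes "c \<in> carrier R"
  shows "gvar R n i \<otimes>\<^bsub>grassmann R n\<^esub> gconst R n c = gconst R n c \<otimes>\<^bsub>grassmann R n\<^esub> gvar R n i"
proof -
  have "gvar R n i \<otimes>\<^bsub>grassmann R n\<^esub> gconst R n c = gmonom R n {i} c"
    unfolding gconst_def by (rule gvar_mult_gmonom) (use assms in auto)
  also have "\<dots> = gconst R n c \<otimes>\<^bsub>grassmann R n\<^esub> gvar R n i"
    by (rule gelem_eqI[of _ n])
      (use assms in \<open>auto simp: gconst_mult_apply gmonom_apply gvar_def\<close>)
  finally show ?thesis .
qed

lemma gvar_prod_eq_gmonom: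
  "sorted_wrt (<) is \<Longrightarrow> gvar_prod R n is = gmonom R n (set is) \<one>"
proof (induction "is")
  case Nil
  then show ?case
    by (simp add: gvar_prod_def gone_eq)
next
  case (Cons i "is")
  then show ?case
    using gvar_mult_gmonom[of "set is" i \<one> n] by (simp add: gvar_prod_def)
qed

lemma gfinsum_apply:
  assumes "finite S" "f \<in> S \<rightarrow> carrier (grassmann R n)" "\<gamma> \<subseteq> {1..n}"
  shows "(\<Oplus>\<^bsub>grassmann R n\<^esub>s\<in>S. f s) \<gamma> = (\<Oplus>s\<in>S. f s \<gamma>)"
  using assms
proof (induction S)
  case empty
  then show ?case
    by (simp add: gzero_apply)
next
  case (insert x S)
  then have "f \<in> S \<rightarrow> carrier (grassmann R n)" "f x \<in> carrier (grassmann R n)"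
    by auto
  moreover from this have "(\<lambda>s. f s \<gamma>) \<in> S \<rightarrow> carrier R" "f x \<gamma> \<in> carrier R"
    using insert.prems(2) by (auto intro!: gelem_closed[of _ n])
  ultimately show ?case
    using insert by (simp add: gadd_apply)
qed

lemma gexpansion:
  assumes "a \<in> carrier (grassmann R n)"
  shows "a = (\<Oplus>\<^bsub>grassmann R n\<^esub>\<alpha>\<in>Pow {1..n}.
    gconst R n (a \<alpha>) \<otimes>\<^bsub>grassmann R n\<^esub> gvar_prod R n (sorted_list_of_set \<alpha>))" (is "_ = ?s")
proof (rule gelem_eqI[of _ n])
  have prod: "gvar_prod R n (sorted_list_of_set \<alpha>) = gmonom R n \<alpha> \<one>" if "\<alpha> \<subseteq> {1..n}" for \<alpha>
    using gvar_prod_eq_gmonom[of "sorted_list_of_set \<alpha>" n] that by simp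
  have cl: "(\<lambda>\<alpha>. gconst R n (a \<alpha>) \<otimes>\<^bsub>grassmann R n\<^esub> gvar_prod R n (sorted_list_of_set \<alpha>))
      \<in> Pow {1..n} \<rightarrow> carrier (grassmann R n)"
    using assms by (auto simp: prod)
  then show "?s \<in> carrier (grassmann R n)"
    by (rule Gr.finsum_closed)
  fix \<gamma> :: "nat set"
  assume \<gamma>: "\<gamma> \<subseteq> {1..n}"
  have "?s \<gamma> = (\<Oplus>\<alpha>\<in>Pow {1..n}.
      (gconst R n (a \<alpha>) \<otimes>\<^bsub>grassmann R n\<^esub> gvar_prod R n (sorted_list_of_set \<alpha>)) \<gamma>)"
    by (rule gfinsum_apply) (use cl \<gamma> in simp_all)
  also have "\<dots> = (gconst R n (a \<gamma>) \<otimes>\<^bsub>grassmann R n\<^esub> gvar_prod R n (sorted_list_of_set \<gamma>)) \<gamma>"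
    by (rule finsum_delta) (use assms \<gamma> in \<open>auto simp: prod gconst_mult_apply gmonom_apply\<close>)
  finally show "a \<gamma> = ?s \<gamma>"
    using assms \<gamma> by (simp add: prod gconst_mult_apply gmonom_apply)
qed (use assms in simp)


section \<open>The skew derivations exist and are unique\<close>

text \<open>The sign is the one picked up when \<open>x\<^sub>i\<close> is moved to the front of \<open>x\<^sup>\<gamma>\<close>, \<open>i \<in> \<gamma>\<close>.\<close>

definition gpartial_coeff :: "nat \<Rightarrow> nat \<Rightarrow> (nat set \<Rightarrow> 'a) \<Rightarrow> (nat set \<Rightarrow> 'a)" where
  "gpartial_coeff n i a = (\<lambda>\<gamma>\<in>Pow {1..n}.
    if i \<in> \<gamma> then \<zero> else signed R (card {j \<in> \<gamma>. j < i}) (a (insert i \<gamma>)))"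

lemma gpartial_coeff_apply:
  "\<gamma> \<subseteq> {1..n} \<Longrightarrow> gpartial_coeff n i a \<gamma> =
    (if i \<in> \<gamma> then \<zero> else signed R (card {j \<in> \<gamma>. j < i}) (a (insert i \<gamma>)))"
  by (simp add: gpartial_coeff_def)

lemma gpartial_coeff_closed:
  assumes "i \<in> {1..n}" "a \<in> carrier (grassmann R n)"
  shows "gpartial_coeff n i a \<in> carrier (grassmann R n)"
  using assms by (auto simp: gpartial_coeff_def gcarrier intro!: PiE_mem)

lemma card_less_Un:
  fixes i :: nat
  assumes "finite \<alpha>" "finite \<beta>" "\<alpha> \<inter> \<beta> = {}"
  shows "card {j \<in> \<alpha> \<union> \<beta>. j < i} = card {j \<in> \<alpha>. j < i} + card {j \<in> \<beta>. j < i}"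
  using inversions_Un_right[of \<alpha> \<beta> "{i}"] assms by (simp add: inversions_single_left)

lemma card_less_greater:
  fixes i :: nat
  assumes "finite \<alpha>" "i \<notin> \<alpha>"
  shows "card {j \<in> \<alpha>. j < i} + card {j \<in> \<alpha>. i < j} = card \<alpha>"
proof -
  have "\<alpha> = {j \<in> \<alpha>. j < i} \<union> {j \<in> \<alpha>. i < j}"
    using assms by (auto simp: not_less_iff_gr_or_eq)
  moreover have "card ({j \<in> \<alpha>. j < i} \<union> {j \<in> \<alpha>. i < j}) =
      card {j \<in> \<alpha>. j < i} + card {j \<in> \<alpha>. i < j}"
    by (rule card_Un_disjoint) (use assms in auto)
  ultimately show ?thesis
    by simp
qed

lemma gpartial_coeff_leibniz:
  assumes i: "i \<in> {1..n}" and b: "b \<in> gcomponent R n d" and c: "c \<in> carrier (grassmann R n)"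
    and \<gamma>: "\<gamma> \<subseteq> {1..n}"
  shows "gpartial_coeff n i (b \<otimes>\<^bsub>grassmann R n\<^esub> c) \<gamma> =
    (gpartial_coeff n i b \<otimes>\<^bsub>grassmann R n\<^esub> c) \<gamma> \<oplus>
    signed R d ((b \<otimes>\<^bsub>grassmann R n\<^esub> gpartial_coeff n i c) \<gamma>)"
proof -
  define p where "p \<alpha> = card {j \<in> \<alpha>. j < i}" for \<alpha> :: "nat set"
  define q where "q \<alpha> = card {j \<in> \<alpha>. i < j}" for \<alpha> :: "nat set"
  define D where "D = gpartial_coeff n i"
  have D: "D a \<alpha> = (if i \<in> \<alpha> then \<zero> else signed R (p \<alpha>) (a (insert i \<alpha>)))"
    if "\<alpha> \<subseteq> {1..n}" for a \<alpha>
    using that by (simp add: D_def p_def gpartial_coeff_apply)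
  have b': "b \<in> carrier (grassmann R n)"
    using b by (simp add: gcomponent_def)
  have bz: "b \<alpha> = \<zero>" if "\<alpha> \<subseteq> {1..n}" "card \<alpha> \<noteq> d" for \<alpha>
    using b that by (simp add: gcomponent_def)
  have Dcl: "D b \<in> carrier (grassmann R n)" "D c \<in> carrier (grassmann R n)"
    using i b' c by (simp_all add: D_def gpartial_coeff_closed)
  define \<delta> where "\<delta> = \<gamma> - {i}"
  have \<delta>: "i \<notin> \<delta>" "\<delta> \<subseteq> {1..n}" "insert i \<delta> \<subseteq> {1..n}" "finite \<delta>"
    using \<gamma> i by (auto simp: \<delta>_def intro: finite_subset)
  have inv_i_left: "inversions (insert i \<alpha>) (\<delta> - \<alpha>) = inversions \<alpha> (\<delta> - \<alpha>) + p (\<delta> - \<alpha>)"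
    if "\<alpha> \<subseteq> \<delta>" for \<alpha>
  proof -
    have "i \<notin> \<alpha>" "finite \<alpha>"
      using that \<delta> by (auto intro: finite_subset)
    then show ?thesis
      using inversions_Un_left[of "{i}" \<alpha> "\<delta> - \<alpha>"] \<delta>(4)
      by (simp add: inversions_single_left p_def)
  qed
  have inv_i_right: "inversions \<alpha> (insert i (\<delta> - \<alpha>)) = inversions \<alpha> (\<delta> - \<alpha>) + q \<alpha>"
    if "\<alpha> \<subseteq> \<delta>" for \<alpha>
  proof -
    have "i \<notin> \<delta> - \<alpha>" "finite \<alpha>"
      using that \<delta> by (auto intro: finite_subset)
    then show ?thesis
      using inversions_Un_right[of "{i}" "\<delta> - \<alpha>" \<alpha>] \<delta>(4)
      by (simp add: inversions_single_right q_def)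
  qed
  have pq: "p \<alpha> + q \<alpha> = card \<alpha>" if "\<alpha> \<subseteq> \<delta>" for \<alpha>
    unfolding p_def q_def
    by (rule card_less_greater) (use that \<delta>(1) finite_subset[OF that \<delta>(4)] in auto)
  have p_split: "p \<delta> = p \<alpha> + p (\<delta> - \<alpha>)" if "\<alpha> \<subseteq> \<delta>" for \<alpha>
    using card_less_Un[of \<alpha> "\<delta> - \<alpha>" i] that \<delta> finite_subset[OF that \<delta>(4)]
    by (simp add: p_def Un_absorb1)
  have diff1: "insert i \<delta> - insert i \<alpha> = \<delta> - \<alpha>" for \<alpha>
    using \<delta> by auto
  have diff2: "insert i \<delta> - \<alpha> = insert i (\<delta> - \<alpha>)" if "\<alpha> \<subseteq> \<delta>" for \<alpha>
    using \<delta> that by auto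
  have sub: "\<alpha> \<subseteq> {1..n}" "insert i \<alpha> \<subseteq> {1..n}" "\<delta> - \<alpha> \<subseteq> {1..n}" "insert i (\<delta> - \<alpha>) \<subseteq> {1..n}"
      "i \<notin> \<alpha>" "finite \<alpha>"
    if "\<alpha> \<subseteq> \<delta>" for \<alpha>
    using \<delta> that by (auto intro: finite_subset)
  show ?thesis
  proof (cases "i \<in> \<gamma>")
    case False
    then have [simp]: "\<delta> = \<gamma>"
      by (simp add: \<delta>_def)
    let ?T = "\<lambda>\<alpha>. signed R (inversions \<alpha> (insert i \<delta> - \<alpha>)) (b \<alpha> \<otimes> c (insert i \<delta> - \<alpha>))"
    let ?U = "\<lambda>\<alpha>. signed R (inversions \<alpha> (\<delta> - \<alpha>)) (D b \<alpha> \<otimes> c (\<delta> - \<alpha>))"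
    let ?V = "\<lambda>\<alpha>. signed R (inversions \<alpha> (\<delta> - \<alpha>)) (b \<alpha> \<otimes> D c (\<delta> - \<alpha>))"
    have T: "?T \<alpha> \<in> carrier R" if "\<alpha> \<subseteq> insert i \<delta>" for \<alpha>
      using gelem_closed_sub(1)[OF b' \<delta>(3) that] gelem_closed_sub(2)[OF c \<delta>(3)] by simp
    have U: "?U \<alpha> \<in> carrier R" and V: "?V \<alpha> \<in> carrier R" if "\<alpha> \<subseteq> \<delta>" for \<alpha>
      using sub[OF that] b' c Dcl by simp_all
    have TU: "signed R (p \<delta>) (?T (insert i \<alpha>)) = ?U \<alpha>" if "\<alpha> \<subseteq> \<delta>" for \<alpha>
    proof -
      have cl: "b (insert i \<alpha>) \<in> carrier R" "c (\<delta> - \<alpha>) \<in> carrier R"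
        using sub[OF that] b' c by simp_all
      then show ?thesis
        unfolding diff1 inv_i_left[OF that] D[OF sub(1)[OF that]] p_split[OF that]
        using sub(5)[OF that] by (auto simp: signed_signed signed_mult_left intro!: signed_cong)
    qed
    have TV: "signed R (p \<delta>) (?T \<alpha>) = signed R d (?V \<alpha>)" if "\<alpha> \<subseteq> \<delta>" for \<alpha>
    proof (cases "card \<alpha> = d")
      case True
      have cl: "b \<alpha> \<in> carrier R" "c (insert i (\<delta> - \<alpha>)) \<in> carrier R"
        using sub[OF that] b' c by simp_all
      have d: "d = p \<alpha> + q \<alpha>"
        using pq[OF that] True by simp
      show ?thesis
        unfolding diff2[OF that] inv_i_right[OF that] D[OF sub(3)[OF that]] p_split[OF that] d
        using cl \<delta>(1) by (auto simp: signed_signed signed_mult_right intro!: signed_cong)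
    next
      case False
      have "c (insert i (\<delta> - \<alpha>)) \<in> carrier R" "D c (\<delta> - \<alpha>) \<in> carrier R"
        using sub[OF that] c Dcl by simp_all
      with False show ?thesis
        unfolding diff2[OF that] bz[OF sub(1)[OF that] False] by simp
    qed
    have "D (b \<otimes>\<^bsub>grassmann R n\<^esub> c) \<delta> = signed R (p \<delta>) (\<Oplus>\<alpha>\<in>Pow (insert i \<delta>). ?T \<alpha>)"
      using \<delta> by (simp only: D gmult_apply if_False)
    also have "\<dots> = (\<Oplus>\<alpha>\<in>Pow (insert i \<delta>). signed R (p \<delta>) (?T \<alpha>))"
      by (rule signed_finsum) (use T in blast)
    also have "\<dots> = (\<Oplus>\<alpha>\<in>Pow \<delta>. signed R (p \<delta>) (?T (insert i \<alpha>))) \<oplus>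
        (\<Oplus>\<alpha>\<in>Pow \<delta>. signed R (p \<delta>) (?T \<alpha>))"
      by (rule finsum_Pow_insert) (use \<delta> T in \<open>auto simp del: insert_Diff_if\<close>)
    also have "(\<Oplus>\<alpha>\<in>Pow \<delta>. signed R (p \<delta>) (?T (insert i \<alpha>))) = (\<Oplus>\<alpha>\<in>Pow \<delta>. ?U \<alpha>)"
      by (rule finsum_cong') (use U TU in blast)+
    also have "(\<Oplus>\<alpha>\<in>Pow \<delta>. signed R (p \<delta>) (?T \<alpha>)) = (\<Oplus>\<alpha>\<in>Pow \<delta>. signed R d (?V \<alpha>))"
      by (rule finsum_cong') (use signed_closed[OF V] TV in blast)+
    also have "(\<Oplus>\<alpha>\<in>Pow \<delta>. signed R d (?V \<alpha>)) = signed R d (\<Oplus>\<alpha>\<in>Pow \<delta>. ?V \<alpha>)"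
      by (rule signed_finsum[symmetric]) (use V in blast)
    finally show ?thesis
      using \<gamma> by (simp add: D_def gmult_apply)
  next
    case True
    then have \<gamma>_eq: "\<gamma> = insert i \<delta>"
      by (auto simp: \<delta>_def)
    let ?U = "\<lambda>\<alpha>. signed R (inversions \<alpha> (insert i \<delta> - \<alpha>)) (D b \<alpha> \<otimes> c (insert i \<delta> - \<alpha>))"
    let ?V = "\<lambda>\<alpha>. signed R (inversions \<alpha> (insert i \<delta> - \<alpha>)) (b \<alpha> \<otimes> D c (insert i \<delta> - \<alpha>))"
    have U: "?U \<alpha> \<in> carrier R" and V: "?V \<alpha> \<in> carrier R" if "\<alpha> \<subseteq> insert i \<delta>" for \<alpha>
      using gelem_closed_sub(1)[OF b' \<delta>(3) that] gelem_closed_sub(1)[OF Dcl(1) \<delta>(3) that]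
        gelem_closed_sub(2)[OF c \<delta>(3)] gelem_closed_sub(2)[OF Dcl(2) \<delta>(3)] by simp_all
    have U': "?U (insert i \<alpha>) \<in> carrier R" "?V (insert i \<alpha>) \<in> carrier R"
        "?U \<alpha> \<in> carrier R" "?V \<alpha> \<in> carrier R" if "\<alpha> \<subseteq> \<delta>" for \<alpha>
      by (intro U V, use that in blast)+
    have U0: "?U (insert i \<alpha>) = \<zero>" if "\<alpha> \<subseteq> \<delta>" for \<alpha>
      unfolding diff1 D[OF sub(2)[OF that]] using sub[OF that] c by simp
    have V0: "?V \<alpha> = \<zero>" if "\<alpha> \<subseteq> \<delta>" for \<alpha>
      unfolding diff2[OF that] D[OF sub(4)[OF that]] using sub[OF that] b' by simp
    have cancel: "?U \<alpha> \<oplus> signed R d (?V (insert i \<alpha>)) = \<zero>" if "\<alpha> \<subseteq> \<delta>" for \<alpha>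
    proof -
      define z where "z = b (insert i \<alpha>) \<otimes> c (insert i (\<delta> - \<alpha>))"
      have cl: "b (insert i \<alpha>) \<in> carrier R" "c (insert i (\<delta> - \<alpha>)) \<in> carrier R" "z \<in> carrier R"
        using sub[OF that] b' c by (simp_all add: z_def)
      have 1: "?U \<alpha> = signed R (inversions \<alpha> (\<delta> - \<alpha>) + q \<alpha> + p \<alpha>) z"
        unfolding diff2[OF that] inv_i_right[OF that] D[OF sub(1)[OF that]] z_def
        using sub[OF that] cl by (simp add: signed_signed signed_mult_left)
      have 2: "signed R d (?V (insert i \<alpha>)) =
          signed R (d + (inversions \<alpha> (\<delta> - \<alpha>) + p (\<delta> - \<alpha>) + p (\<delta> - \<alpha>))) z"
        unfolding diff1 inv_i_left[OF that] D[OF sub(3)[OF that]] z_def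
        using \<delta>(1) cl by (simp add: signed_signed signed_mult_right)
      show ?thesis
      proof (cases "card (insert i \<alpha>) = d")
        case True
        then have "d = Suc (p \<alpha> + q \<alpha>)"
          using sub[OF that] pq[OF that] by simp
        then show ?thesis
          unfolding 1 2 using cl(3) by (auto simp: signed_def l_neg r_neg)
      next
        case False
        then have "z = \<zero>"
          using bz[OF sub(2)[OF that] False] cl by (simp add: z_def)
        then show ?thesis
          unfolding 1 2 by simp
      qed
    qed
    have sU: "(\<Oplus>\<alpha>\<in>Pow (insert i \<delta>). ?U \<alpha>) = (\<Oplus>\<alpha>\<in>Pow \<delta>. ?U \<alpha>)"
    proof -
      have "(\<Oplus>\<alpha>\<in>Pow (insert i \<delta>). ?U \<alpha>) =
          (\<Oplus>\<alpha>\<in>Pow \<delta>. ?U (insert i \<alpha>)) \<oplus> (\<Oplus>\<alpha>\<in>Pow \<delta>. ?U \<alpha>)"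
        by (rule finsum_Pow_insert[OF \<delta>(4,1) U])
      also have "(\<Oplus>\<alpha>\<in>Pow \<delta>. ?U (insert i \<alpha>)) = \<zero>"
        by (rule add.finprod_one_eqI) (use U0 in blast)
      finally show ?thesis
        using U'(3) by (simp add: finsum_closed Pi_def)
    qed
    have sV: "(\<Oplus>\<alpha>\<in>Pow (insert i \<delta>). ?V \<alpha>) = (\<Oplus>\<alpha>\<in>Pow \<delta>. ?V (insert i \<alpha>))"
    proof -
      have "(\<Oplus>\<alpha>\<in>Pow (insert i \<delta>). ?V \<alpha>) =
          (\<Oplus>\<alpha>\<in>Pow \<delta>. ?V (insert i \<alpha>)) \<oplus> (\<Oplus>\<alpha>\<in>Pow \<delta>. ?V \<alpha>)"
        by (rule finsum_Pow_insert[OF \<delta>(4,1) V])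
      also have "(\<Oplus>\<alpha>\<in>Pow \<delta>. ?V \<alpha>) = \<zero>"
        by (rule add.finprod_one_eqI) (use V0 in blast)
      finally show ?thesis
        using U'(2) by (simp add: finsum_closed Pi_def)
    qed
    have "(D b \<otimes>\<^bsub>grassmann R n\<^esub> c) \<gamma> \<oplus> signed R d ((b \<otimes>\<^bsub>grassmann R n\<^esub> D c) \<gamma>) =
        (\<Oplus>\<alpha>\<in>Pow \<delta>. ?U \<alpha>) \<oplus> signed R d (\<Oplus>\<alpha>\<in>Pow \<delta>. ?V (insert i \<alpha>))"
      unfolding \<gamma>_eq gmult_apply[OF \<delta>(3)] sU sV ..
    also have "signed R d (\<Oplus>\<alpha>\<in>Pow \<delta>. ?V (insert i \<alpha>)) =
        (\<Oplus>\<alpha>\<in>Pow \<delta>. signed R d (?V (insert i \<alpha>)))"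
      by (rule signed_finsum) (use U'(2) in blast)
    also have "(\<Oplus>\<alpha>\<in>Pow \<delta>. ?U \<alpha>) \<oplus> (\<Oplus>\<alpha>\<in>Pow \<delta>. signed R d (?V (insert i \<alpha>))) =
        (\<Oplus>\<alpha>\<in>Pow \<delta>. ?U \<alpha> \<oplus> signed R d (?V (insert i \<alpha>)))"
      by (rule finsum_addf[symmetric]) (use U'(3) signed_closed[OF U'(2)] in blast)+
    also have "\<dots> = \<zero>"
      by (rule add.finprod_one_eqI) (use cancel in blast)
    also have "\<zero> = D (b \<otimes>\<^bsub>grassmann R n\<^esub> c) \<gamma>"
      using True \<gamma> by (simp add: D)
    finally show ?thesis
      by (simp add: D_def)
  qed
qed

lemma is_gpartial_gpartial_coeff:
  assumes i: "i \<in> {1..n}"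
  shows "is_gpartial R n i (restrict (gpartial_coeff n i) (carrier (grassmann R n)))"
proof -
  let ?L = "grassmann R n" and ?D = "gpartial_coeff n i"
  have ins: "insert i \<gamma> \<subseteq> {1..n}" if "\<gamma> \<subseteq> {1..n}" for \<gamma>
    using that i by auto
  have "?D (b \<oplus>\<^bsub>?L\<^esub> c) = ?D b \<oplus>\<^bsub>?L\<^esub> ?D c" if "b \<in> carrier ?L" "c \<in> carrier ?L" for b c
  proof (rule gelem_eqI[of _ n])
    fix \<gamma> :: "nat set"
    assume \<gamma>: "\<gamma> \<subseteq> {1..n}"
    show "?D (b \<oplus>\<^bsub>?L\<^esub> c) \<gamma> = (?D b \<oplus>\<^bsub>?L\<^esub> ?D c) \<gamma>"
      using that \<gamma> gelem_closed[OF that(1) ins[OF \<gamma>]] gelem_closed[OF that(2) ins[OF \<gamma>]]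
      by (simp add: gpartial_coeff_apply gadd_apply[OF \<gamma>] gadd_apply[OF ins[OF \<gamma>]] signed_add)
  qed (use that i in \<open>simp_all add: gpartial_coeff_closed\<close>)
  moreover have "?D (gconst R n c) = \<zero>\<^bsub>?L\<^esub>" if "c \<in> carrier R" for c
  proof (rule gelem_eqI[of _ n])
    fix \<gamma> :: "nat set"
    assume \<gamma>: "\<gamma> \<subseteq> {1..n}"
    show "?D (gconst R n c) \<gamma> = \<zero>\<^bsub>?L\<^esub> \<gamma>"
      by (simp add: gpartial_coeff_apply[OF \<gamma>] gzero_apply[OF \<gamma>] gconst_def
          gmonom_apply[OF ins[OF \<gamma>]])
  qed (use that i in \<open>simp_all add: gpartial_coeff_closed\<close>)
  moreover have "?D (gvar R n j) = (if i = j then \<one>\<^bsub>?L\<^esub> else \<zero>\<^bsub>?L\<^esub>)" for j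
  proof (rule gelem_eqI[of _ n])
    fix \<gamma> :: "nat set"
    assume \<gamma>: "\<gamma> \<subseteq> {1..n}"
    have val: "?D (gvar R n j) \<gamma> = (if i \<in> \<gamma> then \<zero> else
        signed R (card {k \<in> \<gamma>. k < i}) (if insert i \<gamma> = {j} then \<one> else \<zero>))"
      unfolding gpartial_coeff_apply[OF \<gamma>] gvar_def gmonom_apply[OF ins[OF \<gamma>]] ..
    show "?D (gvar R n j) \<gamma> = (if i = j then \<one>\<^bsub>?L\<^esub> else \<zero>\<^bsub>?L\<^esub>) \<gamma>"
    proof (cases "i = j \<and> \<gamma> = {}")
      case True
      then show ?thesis
        unfolding val using \<gamma> by (simp add: gone_apply)
    next
      case False
      then have "i \<in> \<gamma> \<or> insert i \<gamma> \<noteq> {j}"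
        by auto
      then show ?thesis
        unfolding val using \<gamma> False by (auto simp: gzero_apply gone_apply)
    qed
  qed (use i in \<open>simp_all add: gpartial_coeff_closed\<close>)
  moreover have "?D (b \<otimes>\<^bsub>?L\<^esub> c) =
      ?D b \<otimes>\<^bsub>?L\<^esub> c \<oplus>\<^bsub>?L\<^esub> (\<ominus>\<^bsub>?L\<^esub> \<one>\<^bsub>?L\<^esub>) [^]\<^bsub>?L\<^esub> d \<otimes>\<^bsub>?L\<^esub> (b \<otimes>\<^bsub>?L\<^esub> ?D c)"
    if b: "b \<in> gcomponent R n d" and c: "c \<in> carrier ?L" for b c d
  proof -
    have b': "b \<in> carrier ?L"
      using b by (simp add: gcomponent_def)
    have Dcl: "?D b \<in> carrier ?L" "?D c \<in> carrier ?L" "?D (b \<otimes>\<^bsub>?L\<^esub> c) \<in> carrier ?L"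
      using i b' c by (simp_all add: gpartial_coeff_closed)
    show ?thesis
      by (rule gelem_eqI[of _ n])
        (use b' c Dcl in \<open>simp_all add: gadd_apply gsign_mult_apply gpartial_coeff_leibniz[OF i b c]\<close>)
  qed
  ultimately show ?thesis
    using i unfolding is_gpartial_def Let_def
    by (auto simp: gpartial_coeff_closed gcomponent_def)
qed

lemma is_gpartial_add:
  assumes "is_gpartial R n i D" "b \<in> carrier (grassmann R n)" "c \<in> carrier (grassmann R n)"
  shows "D (b \<oplus>\<^bsub>grassmann R n\<^esub> c) = D b \<oplus>\<^bsub>grassmann R n\<^esub> D c"
  using assms unfolding is_gpartial_def Let_def by blast

lemma is_gpartial_gconst:
  "\<lbrakk>is_gpartial R n i D; c \<in> carrier R\<rbrakk> \<Longrightarrow> D (gconst R n c) = \<zero>\<^bsub>grassmann R n\<^esub>"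
  unfolding is_gpartial_def Let_def by blast

lemma is_gpartial_gvar:
  assumes "is_gpartial R n i D" "j \<in> {1..n}"
  shows "D (gvar R n j) = (if i = j then \<one>\<^bsub>grassmann R n\<^esub> else \<zero>\<^bsub>grassmann R n\<^esub>)"
  using assms unfolding is_gpartial_def Let_def by blast

lemma is_gpartial_leibniz:
  assumes "is_gpartial R n i D" "b \<in> gcomponent R n d" "c \<in> carrier (grassmann R n)"
  shows "D (b \<otimes>\<^bsub>grassmann R n\<^esub> c) = D b \<otimes>\<^bsub>grassmann R n\<^esub> c \<oplus>\<^bsub>grassmann R n\<^esub>
    (\<ominus>\<^bsub>grassmann R n\<^esub> \<one>\<^bsub>grassmann R n\<^esub>) [^]\<^bsub>grassmann R n\<^esub> d \<otimes>\<^bsub>grassmann R n\<^esub>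
      (b \<otimes>\<^bsub>grassmann R n\<^esub> D c)"
  using assms unfolding is_gpartial_def Let_def by blast

lemma is_gpartial_unique:
  assumes D: "is_gpartial R n i D" and D': "is_gpartial R n i D'"
    and a: "a \<in> carrier (grassmann R n)"
  shows "D a = D' a"
proof -
  let ?L = "grassmann R n"
  have zero: "gconst R n \<zero> = \<zero>\<^bsub>?L\<^esub>"
    by (auto simp: gconst_def gmonom_def grassmann_def)
  have var: "gvar R n j \<in> gcomponent R n 1" for j
    by (auto simp: gcomponent_def gvar_def gmonom_apply)
  have mon: "D (gmonom R n \<alpha> c) = D' (gmonom R n \<alpha> c)"
    if "finite \<alpha>" "\<alpha> \<subseteq> {1..n}" "c \<in> carrier R" for \<alpha> c
    using that(1,2)
  proof (induction \<alpha> rule: finite_linorder_min_induct)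
    case empty
    show ?case
      using is_gpartial_gconst[OF D that(3)] is_gpartial_gconst[OF D' that(3)]
      by (simp add: gconst_def)
  next
    case (insert j \<alpha>)
    have eq: "gmonom R n (insert j \<alpha>) c = gvar R n j \<otimes>\<^bsub>?L\<^esub> gmonom R n \<alpha> c"
      by (rule gvar_mult_gmonom[symmetric]) (use insert that(3) in auto)
    have j: "j \<in> {1..n}" and cl: "gmonom R n \<alpha> c \<in> carrier ?L"
      using insert.prems that(3) by auto
    show ?case
      unfolding eq is_gpartial_leibniz[OF D var cl] is_gpartial_leibniz[OF D' var cl]
        is_gpartial_gvar[OF D j] is_gpartial_gvar[OF D' j] using insert by simp
  qed
  have "D a = D' a"
    if "finite S" "a \<in> carrier ?L" "S \<subseteq> Pow {1..n}"
      "\<And>\<gamma>. \<gamma> \<subseteq> {1..n} \<Longrightarrow> \<gamma> \<notin> S \<Longrightarrow> a \<gamma> = \<zero>" for S a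
    using that
  proof (induction S arbitrary: a)
    case empty
    then have "a = gconst R n \<zero>"
      by (intro gelem_eqI[of _ n]) (auto simp: zero gzero_apply)
    then show ?case
      by (simp add: is_gpartial_gconst[OF D] is_gpartial_gconst[OF D'])
  next
    case (insert \<alpha> S)
    define a' where "a' = (\<lambda>\<gamma>\<in>Pow {1..n}. if \<gamma> = \<alpha> then \<zero> else a \<gamma>)"
    have a'_apply: "a' \<gamma> = (if \<gamma> = \<alpha> then \<zero> else a \<gamma>)" if "\<gamma> \<subseteq> {1..n}" for \<gamma>
      using that by (simp add: a'_def)
    have a': "a' \<in> carrier ?L"
      using insert.prems(1) by (auto simp: a'_def gcarrier)
    have \<alpha>: "\<alpha> \<subseteq> {1..n}" "a \<alpha> \<in> carrier R"
      using insert.prems by auto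
    have "D a' = D' a'"
      by (rule insert.IH) (use insert.prems a' in \<open>auto simp: a'_apply\<close>)
    moreover have "D (gmonom R n \<alpha> (a \<alpha>)) = D' (gmonom R n \<alpha> (a \<alpha>))"
      by (rule mon) (use \<alpha> in \<open>auto intro: finite_subset\<close>)
    moreover have "a = a' \<oplus>\<^bsub>?L\<^esub> gmonom R n \<alpha> (a \<alpha>)"
    proof (rule gelem_eqI[of _ n])
      show "a \<gamma> = (a' \<oplus>\<^bsub>?L\<^esub> gmonom R n \<alpha> (a \<alpha>)) \<gamma>" if "\<gamma> \<subseteq> {1..n}" for \<gamma>
        using that insert.prems(1) by (simp add: gadd_apply a'_apply gmonom_apply)
    qed (use insert.prems(1) a' \<alpha> in simp_all)
    moreover have "gmonom R n \<alpha> (a \<alpha>) \<in> carrier ?L"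
      using \<alpha> by simp
    ultimately show ?case
      using is_gpartial_add[OF D a'] is_gpartial_add[OF D' a'] by metis
  qed
  from this[of "Pow {1..n}" a] show ?thesis
    using a by simp
qed

theorem gpartial_ex1:
  assumes "i \<in> {1..n}"
  shows "\<exists>!D. D \<in> extensional (carrier (grassmann R n)) \<and> is_gpartial R n i D"
proof (rule ex1I)
  show "restrict (gpartial_coeff n i) (carrier (grassmann R n)) \<in>
      extensional (carrier (grassmann R n)) \<and>
      is_gpartial R n i (restrict (gpartial_coeff n i) (carrier (grassmann R n)))"
    using is_gpartial_gpartial_coeff[OF assms] by simp
next
  fix D
  assume "D \<in> extensional (carrier (grassmann R n)) \<and> is_gpartial R n i D"
  then show "D = restrict (gpartial_coeff n i) (carrier (grassmann R n))"
    by (intro extensionalityI[of _ "carrier (grassmann R n)"]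
        is_gpartial_unique[OF _ is_gpartial_gpartial_coeff[OF assms]]) auto
qed

corollary is_gpartial_gpartial:
  assumes "i \<in> {1..n}"
  shows "is_gpartial R n i (gpartial R n i)"
  using theI'[OF gpartial_ex1[OF assms]] unfolding gpartial_def by blast

corollary gpartial_eq_coeff:
  assumes "i \<in> {1..n}" "a \<in> carrier (grassmann R n)"
  shows "gpartial R n i a = gpartial_coeff n i a"
  using is_gpartial_unique[OF is_gpartial_gpartial is_gpartial_gpartial_coeff] assms by simp

end

end

theory Submission
  imports Defs
begin

text \<open>
  The equation \<open>x\<^sub>k a = u\<^sub>k\<close> says two things: \<open>u\<^sub>k\<close> involves only monomials containing \<open>x\<^sub>k\<close>,
  i.e. \<open>u\<^sub>k \<in> (x\<^sub>k)\<close>, and the part of \<open>a\<close> free of \<open>x\<^sub>k\<close> is \<open>v\<^sub>k = \<partial>\<^sub>k(u\<^sub>k)\<close>. So only the coefficient of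
  \<open>x\<^sub>1 \<cdots> x\<^sub>n\<close> is free, and the system is solvable iff \<open>v\<^sub>i\<close> and \<open>v\<^sub>j\<close> have the same part free of both \<open>x\<^sub>i\<close>
  and \<open>x\<^sub>j\<close>; this is the relation \<open>x\<^sub>iu\<^sub>j = -x\<^sub>ju\<^sub>i\<close>. The explicit formula sorts the other monomials
  by the least \<open>m\<close> with \<open>x\<^sub>m\<close> missing: \<open>x\<^sub>1 \<cdots> x\<^sub>i \<partial>\<^sub>i \<cdots> \<partial>\<^sub>1\<close> is the projection onto the monomials
  divisible by \<open>x\<^sub>1 \<cdots> x\<^sub>i\<close>.
\<close>

context ring
begin

interpretation Gr: ring "grassmann R n" for n
  by (rule grassmann_ring)

section \<open>Coefficients of partial derivatives and of their products with the variables\<close>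

lemma signed_twice: "c \<in> carrier R \<Longrightarrow> signed R m (signed R m c) = c"
  by (simp add: signed_def)

lemma gpartial_closed:
  assumes "i \<in> {1..n}" "a \<in> carrier (grassmann R n)"
  shows "gpartial R n i a \<in> carrier (grassmann R n)"
  using assms by (simp add: gpartial_eq_coeff gpartial_coeff_closed)

lemma gpartial_apply:
  assumes "i \<in> {1..n}" "a \<in> carrier (grassmann R n)" "\<gamma> \<subseteq> {1..n}"
  shows "gpartial R n i a \<gamma> =
    (if i \<in> \<gamma> then \<zero> else signed R (card {j \<in> \<gamma>. j < i}) (a (insert i \<gamma>)))"
  unfolding gpartial_eq_coeff[OF assms(1,2)] by (rule gpartial_coeff_apply[OF assms(3)])

text \<open>The sign picked up when x_i is split off a monomial and the sign picked up when it is
  multiplied back both count the indices below \<open>i\<close>. That count does not see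
  \<open>i\<close> itself, so the two signs cancel, and x_i \<partial>_i is the projection onto the
  monomials containing x_i.\<close>

lemma gvar_mult_gpartial_apply:
  assumes "i \<in> {1..n}" "a \<in> carrier (grassmann R n)" "\<gamma> \<subseteq> {1..n}"
  shows "(gvar R n i \<otimes>\<^bsub>grassmann R n\<^esub> gpartial R n i a) \<gamma> = (if i \<in> \<gamma> then a \<gamma> else \<zero>)"
proof (cases "i \<in> \<gamma>")
  case True
  have "{j \<in> \<gamma> - {i}. j < i} = {j \<in> \<gamma>. j < i}" "insert i (\<gamma> - {i}) = \<gamma>" "\<gamma> - {i} \<subseteq> {1..n}"
    using True assms(3) by auto
  then show ?thesis
    using True assms by (simp add: gvar_mult_apply gpartial_closed gpartial_apply signed_twice)
qed (use assms in \<open>simp add: gvar_mult_apply gpartial_closed\<close>)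

text \<open>The same cancellation in the opposite order: \<partial>_i is a left inverse of
  multiplication by x_i on the part free of x_i.\<close>

lemma gpartial_gvar_mult_apply:
  assumes "i \<in> {1..n}" "a \<in> carrier (grassmann R n)" "\<gamma> \<subseteq> {1..n}" "i \<notin> \<gamma>"
  shows "gpartial R n i (gvar R n i \<otimes>\<^bsub>grassmann R n\<^esub> a) \<gamma> = a \<gamma>"
proof -
  have "{j \<in> insert i \<gamma>. j < i} = {j \<in> \<gamma>. j < i}" "insert i \<gamma> - {i} = \<gamma>" "insert i \<gamma> \<subseteq> {1..n}"
    using assms by auto
  then show ?thesis
    using assms by (simp add: gpartial_apply gvar_mult_apply signed_twice)
qed

lemma fold_gpartial_closed:
  assumes "set is \<subseteq> {1..n}" "a \<in> carrier (grassmann R n)"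
  shows "fold (gpartial R n) is a \<in> carrier (grassmann R n)"
  using assms by (induction "is" arbitrary: a) (auto simp: gpartial_closed)

lemma gvar_prod_closed: "gvar_prod R n is \<in> carrier (grassmann R n)"
  by (induction "is") (simp_all add: gvar_prod_def)

text \<open>\<open>fold\<close> applies the derivative of the head of the list first, while
  \<open>gvar_prod\<close> puts its variable leftmost. The operators are therefore nested as x_i
  (...) \<partial>_i, and induction on the list composes the projections x_i \<partial>_i.\<close>

lemma gvar_prod_fold_gpartial_apply:
  assumes "distinct is" "set is \<subseteq> {1..n}" "a \<in> carrier (grassmann R n)" "\<gamma> \<subseteq> {1..n}"
  shows "(gvar_prod R n is \<otimes>\<^bsub>grassmann R n\<^esub> fold (gpartial R n) is a) \<gamma> =
    (if set is \<subseteq> \<gamma> then a \<gamma> else \<zero>)"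
  using assms
proof (induction "is" arbitrary: a \<gamma>)
  case Nil
  then show ?case
    by (simp add: gvar_prod_def)
next
  case (Cons i "is")
  let ?L = "grassmann R n"
  let ?D = "gpartial R n" and ?b = "gpartial R n i a"
  have i: "i \<in> {1..n}" "i \<notin> set is" and b: "?b \<in> carrier ?L" "fold ?D is ?b \<in> carrier ?L"
    and sub: "\<gamma> - {i} \<subseteq> {1..n}" "insert i \<gamma> \<subseteq> {1..n}"
    using Cons.prems by (auto intro!: gpartial_closed fold_gpartial_closed)
  have split: "gvar_prod R n (i # is) \<otimes>\<^bsub>?L\<^esub> fold ?D (i # is) a =
      gvar R n i \<otimes>\<^bsub>?L\<^esub> (gvar_prod R n is \<otimes>\<^bsub>?L\<^esub> fold ?D is ?b)"
    using b gvar_prod_closed[of n "is"] by (simp add: gvar_prod_def Gr.m_assoc)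
  \<comment> \<open>The outer x_i reads its argument at \<open>\<gamma> - {i}\<close>. Distinctness
    of the list gives \<open>i \<notin> set is\<close>, so removing \<open>i\<close> from
    \<open>\<gamma>\<close> does not affect the test
    \<open>set is \<subseteq> \<gamma>\<close>.\<close>
  have "(gvar R n i \<otimes>\<^bsub>?L\<^esub> (gvar_prod R n is \<otimes>\<^bsub>?L\<^esub> fold ?D is ?b)) \<gamma> =
      (if set is \<subseteq> \<gamma> then (gvar R n i \<otimes>\<^bsub>?L\<^esub> ?b) \<gamma> else \<zero>)"
    using Cons.IH[of ?b "\<gamma> - {i}"] Cons.prems i b sub gvar_prod_closed[of n "is"]
    by (auto simp: gvar_mult_apply)
  then show ?case
    unfolding split using Cons.prems i by (simp add: gvar_mult_gpartial_apply)
qed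

section \<open>The ideal generated by x_i, and a single equation x_i a = b\<close>

text \<open>An upper bound for the ideal generated by x_i. A coefficient of a product at
  \<open>\<gamma>\<close> involves only coefficients of the factors at subsets of
  \<open>\<gamma>\<close>, and these all miss \<open>i\<close> when \<open>\<gamma>\<close>
  does.\<close>

lemma gvanish_ideal:
  "ideal {a \<in> carrier (grassmann R n). \<forall>\<gamma>\<subseteq>{1..n}. i \<notin> \<gamma> \<longrightarrow> a \<gamma> = \<zero>} (grassmann R n)"
    (is "ideal ?I ?L")
proof (rule idealI)
  show "subgroup ?I (add_monoid ?L)"
    by (rule Gr.add.subgroupI)
      (auto simp: gadd_apply gzero_apply gminus_apply a_inv_def[symmetric]
        intro!: exI[of _ "\<zero>\<^bsub>?L\<^esub>"])
  fix a b
  assume a: "a \<in> ?I" and b: "b \<in> carrier ?L"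
  have "(a \<otimes>\<^bsub>?L\<^esub> b) \<gamma> = \<zero> \<and> (b \<otimes>\<^bsub>?L\<^esub> a) \<gamma> = \<zero>" if \<gamma>: "\<gamma> \<subseteq> {1..n}" "i \<notin> \<gamma>" for \<gamma>
  proof -
    have a0: "a \<alpha> = \<zero>" if "\<alpha> \<subseteq> {1..n}" "i \<notin> \<alpha>" for \<alpha>
      using a that by blast
    have "a \<alpha> = \<zero>" "a (\<gamma> - \<alpha>) = \<zero>" if "\<alpha> \<subseteq> \<gamma>" for \<alpha>
      by (rule a0; use \<gamma> that in blast)+
    then show ?thesis
      unfolding gmult_apply[OF \<gamma>(1)] using gelem_closed_sub[OF b \<gamma>(1)]
      by (intro conjI add.finprod_one_eqI) simp_all
  qed
  then show "b \<otimes>\<^bsub>?L\<^esub> a \<in> ?I" "a \<otimes>\<^bsub>?L\<^esub> b \<in> ?I"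
    using a b by auto
qed (rule grassmann_ring)

text \<open>One direction is minimality of the generated ideal against the ideal of the preceding
  lemma. For the other, an element all of whose monomials contain x_i is fixed by the projection x_i
  \<partial>_i, hence is a right multiple of x_i.\<close>

lemma mem_Idl_gvar_iff:
  assumes i: "i \<in> {1..n}" and a: "a \<in> carrier (grassmann R n)"
  shows "a \<in> Idl\<^bsub>grassmann R n\<^esub> {gvar R n i} \<longleftrightarrow> (\<forall>\<gamma>\<subseteq>{1..n}. i \<notin> \<gamma> \<longrightarrow> a \<gamma> = \<zero>)"
proof
  let ?L = "grassmann R n"
  let ?I = "{a \<in> carrier ?L. \<forall>\<gamma>\<subseteq>{1..n}. i \<notin> \<gamma> \<longrightarrow> a \<gamma> = \<zero>}"
  assume "a \<in> Idl\<^bsub>?L\<^esub> {gvar R n i}"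
  moreover have "Idl\<^bsub>?L\<^esub> {gvar R n i} \<subseteq> ?I"
    by (rule Gr.genideal_minimal[OF gvanish_ideal]) (auto simp: gvar_def gmonom_apply)
  ultimately show "\<forall>\<gamma>\<subseteq>{1..n}. i \<notin> \<gamma> \<longrightarrow> a \<gamma> = \<zero>"
    by blast
next
  let ?L = "grassmann R n"
  assume a0: "\<forall>\<gamma>\<subseteq>{1..n}. i \<notin> \<gamma> \<longrightarrow> a \<gamma> = \<zero>"
  have "a = gvar R n i \<otimes>\<^bsub>?L\<^esub> gpartial R n i a"
    by (rule gelem_eqI[of _ n])
      (use a0 i a in \<open>auto simp: gvar_mult_gpartial_apply gpartial_closed\<close>)
  also have "\<dots> \<in> Idl\<^bsub>?L\<^esub> {gvar R n i}"
    by (rule ideal.I_r_closed[OF Gr.genideal_ideal Gr.genideal_self'])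
      (use i a in \<open>auto simp: gpartial_closed\<close>)
  finally show "a \<in> Idl\<^bsub>?L\<^esub> {gvar R n i}" .
qed

text \<open>Multiplication by x_i reads only the coefficients at sets without \<open>i\<close>, and
  there \<partial>_i inverts it. An equation thus fixes exactly these coefficients of the unknown
  and leaves the others free.\<close>

lemma gvar_mult_eq_iff:
  assumes i: "i \<in> {1..n}" and a: "a \<in> carrier (grassmann R n)" and b: "b \<in> carrier (grassmann R n)"
  shows "gvar R n i \<otimes>\<^bsub>grassmann R n\<^esub> a = b \<longleftrightarrow>
    b \<in> Idl\<^bsub>grassmann R n\<^esub> {gvar R n i} \<and>
    (\<forall>\<gamma>\<subseteq>{1..n}. i \<notin> \<gamma> \<longrightarrow> a \<gamma> = gpartial R n i b \<gamma>)"
proof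
  assume "gvar R n i \<otimes>\<^bsub>grassmann R n\<^esub> a = b"
  then show "b \<in> Idl\<^bsub>grassmann R n\<^esub> {gvar R n i} \<and>
      (\<forall>\<gamma>\<subseteq>{1..n}. i \<notin> \<gamma> \<longrightarrow> a \<gamma> = gpartial R n i b \<gamma>)"
    using i a by (auto simp: mem_Idl_gvar_iff[OF i b] gpartial_gvar_mult_apply gvar_mult_apply)
next
  assume *: "b \<in> Idl\<^bsub>grassmann R n\<^esub> {gvar R n i} \<and>
      (\<forall>\<gamma>\<subseteq>{1..n}. i \<notin> \<gamma> \<longrightarrow> a \<gamma> = gpartial R n i b \<gamma>)"
  show "gvar R n i \<otimes>\<^bsub>grassmann R n\<^esub> a = b"
  proof (rule gelem_eqI[of _ n])
    fix \<gamma> :: "nat set"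
    assume \<gamma>: "\<gamma> \<subseteq> {1..n}"
    then have sub: "\<gamma> - {i} \<subseteq> {1..n}"
      by auto
    have "(gvar R n i \<otimes>\<^bsub>grassmann R n\<^esub> a) \<gamma> =
        (gvar R n i \<otimes>\<^bsub>grassmann R n\<^esub> gpartial R n i b) \<gamma>"
      using * \<gamma> sub i a b by (simp add: gvar_mult_apply gpartial_closed)
    also have "\<dots> = b \<gamma>"
      using * \<gamma> i b by (simp add: gvar_mult_gpartial_apply mem_Idl_gvar_iff)
    finally show "(gvar R n i \<otimes>\<^bsub>grassmann R n\<^esub> a) \<gamma> = b \<gamma>" .
  qed (use a b in simp_all)
qed

text \<open>The relation is compared at the single set \<open>insert i (insert j \<gamma>)\<close>.
  Since \<open>i < j\<close>, the index \<open>i\<close> adds one to the count below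
  \<open>j\<close> but \<open>j\<close> adds nothing to the count below \<open>i\<close>; this extra
  sign cancels the minus of the relation.\<close>

lemma gpartial_compatible:
  assumes ij: "i \<in> {1..n}" "j \<in> {1..n}" "i < j"
    and a: "a \<in> carrier (grassmann R n)" and b: "b \<in> carrier (grassmann R n)"
    and rel: "gvar R n i \<otimes>\<^bsub>grassmann R n\<^esub> b =
      \<ominus>\<^bsub>grassmann R n\<^esub> (gvar R n j \<otimes>\<^bsub>grassmann R n\<^esub> a)"
    and \<gamma>: "\<gamma> \<subseteq> {1..n}" "i \<notin> \<gamma>" "j \<notin> \<gamma>"
  shows "gpartial R n i a \<gamma> = gpartial R n j b \<gamma>"
proof -
  define p q where "p = card {k \<in> \<gamma>. k < i}" and "q = card {k \<in> \<gamma>. k < j}"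
  let ?\<delta> = "insert i (insert j \<gamma>)"
  have \<delta>: "?\<delta> \<subseteq> {1..n}" "insert i \<gamma> \<subseteq> {1..n}" "insert j \<gamma> \<subseteq> {1..n}"
      "?\<delta> - {i} = insert j \<gamma>" "?\<delta> - {j} = insert i \<gamma>"
    using ij \<gamma> by auto
  have cl: "a (insert i \<gamma>) \<in> carrier R" "b (insert j \<gamma>) \<in> carrier R"
    using a b \<delta> by simp_all
  have "{k \<in> ?\<delta>. k < i} = {k \<in> \<gamma>. k < i}" "{k \<in> ?\<delta>. k < j} = insert i {k \<in> \<gamma>. k < j}"
    using ij by auto
  then have card: "card {k \<in> ?\<delta>. k < i} = p" "card {k \<in> ?\<delta>. k < j} = Suc q"
    using \<gamma> by (simp_all only: p_def q_def) simp
  have "(gvar R n i \<otimes>\<^bsub>grassmann R n\<^esub> b) ?\<delta> = signed R p (b (insert j \<gamma>))"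
    unfolding gvar_mult_apply[OF b \<delta>(1)] card \<delta>(4) by simp
  moreover have "(gvar R n j \<otimes>\<^bsub>grassmann R n\<^esub> a) ?\<delta> = signed R (Suc q) (a (insert i \<gamma>))"
    unfolding gvar_mult_apply[OF a \<delta>(1)] card \<delta>(5) by simp
  ultimately have "signed R p (b (insert j \<gamma>)) = \<ominus> signed R (Suc q) (a (insert i \<gamma>))"
    unfolding rel gminus_apply[OF gmult_closed[OF gvar_closed a] \<delta>(1)] by simp
  then have "signed R p (b (insert j \<gamma>)) = signed R q (a (insert i \<gamma>))"
    using cl by (simp add: signed_def)
  \<comment> \<open>The signs stand on the wrong sides for the claim. Signs square to the identity,
    so the previous equation can be solved for the coefficient of \<open>a\<close>, and then
    \<open>p + q + p\<close> has the parity of \<open>q\<close>.\<close>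
  then have "signed R p (a (insert i \<gamma>)) = signed R p (signed R q (signed R p (b (insert j \<gamma>))))"
    using cl by (simp add: signed_twice)
  also have "\<dots> = signed R q (b (insert j \<gamma>))"
    using cl by (simp add: signed_signed signed_def)
  finally show ?thesis
    using ij a b \<gamma> by (simp add: gpartial_apply p_def q_def)
qed

section \<open>The explicit formula and its coefficients\<close>

lemma gvar_prod_mult_gconst_apply:
  assumes "c \<in> carrier R" "\<gamma> \<subseteq> {1..n}"
  shows "(gvar_prod R n [1..<Suc n] \<otimes>\<^bsub>grassmann R n\<^esub> gconst R n c) \<gamma> =
    (if \<gamma> = {1..n} then c else \<zero>)"
proof -
  have "set [1..<Suc n] = {1..n}"
    by auto
  then have "gvar_prod R n [1..<Suc n] = gmonom R n {1..n} \<one>"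
    using gvar_prod_eq_gmonom[of "[1..<Suc n]" n] by (simp del: upt_Suc)
  then show ?thesis
    using assms by (auto simp: gmonom_mult_apply gconst_def gmonom_apply)
qed

text \<open>The right-hand side of the claimed formula, with \<open>c\<close> as the free constant.
  As \<open>fold\<close> runs through the list from the left, \<partial>_1 acts directly after
  \<partial>_(i+1) and \<partial>_i acts last. For \<open>n = 1\<close> the sum is empty.\<close>

definition gsolution :: "nat \<Rightarrow> (nat \<Rightarrow> nat set \<Rightarrow> 'a) \<Rightarrow> 'a \<Rightarrow> (nat set \<Rightarrow> 'a)" where
  "gsolution n u c =
    gvar_prod R n [1..<Suc n] \<otimes>\<^bsub>grassmann R n\<^esub> gconst R n c
    \<oplus>\<^bsub>grassmann R n\<^esub> (\<Oplus>\<^bsub>grassmann R n\<^esub>i\<in>{1..n - 1}. gvar_prod R n [1..<Suc i]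
      \<otimes>\<^bsub>grassmann R n\<^esub> fold (gpartial R n) [1..<Suc i] (gpartial R n (i + 1) (u (i + 1))))
    \<oplus>\<^bsub>grassmann R n\<^esub> gpartial R n 1 (u 1)"

context
  fixes n :: nat and u :: "nat \<Rightarrow> nat set \<Rightarrow> 'a"
  assumes n: "n \<ge> 1" and u: "\<And>i. i \<in> {1..n} \<Longrightarrow> u i \<in> carrier (grassmann R n)"
begin

lemma gsolution_summand_closed:
  assumes "i \<in> {1..n - 1}"
  shows "gvar_prod R n [1..<Suc i] \<otimes>\<^bsub>grassmann R n\<^esub>
      fold (gpartial R n) [1..<Suc i] (gpartial R n (i + 1) (u (i + 1))) \<in> carrier (grassmann R n)"
  using assms by (intro gmult_closed gvar_prod_closed fold_gpartial_closed gpartial_closed u) auto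

lemma gsolution_closed:
  assumes "c \<in> carrier R"
  shows "gsolution n u c \<in> carrier (grassmann R n)"
  unfolding gsolution_def
  by (intro gadd_closed gmult_closed gvar_prod_closed gconst_closed gpartial_closed u
      Gr.finsum_closed Pi_I gsolution_summand_closed) (use assms n in auto)

lemma gsolution_apply:
  assumes c: "c \<in> carrier R" and \<gamma>: "\<gamma> \<subseteq> {1..n}"
  shows "gsolution n u c \<gamma> = (if \<gamma> = {1..n} then c else \<zero>) \<oplus>
    (\<Oplus>i\<in>{1..n - 1}. if {1..i} \<subseteq> \<gamma> then gpartial R n (i + 1) (u (i + 1)) \<gamma> else \<zero>) \<oplus>
    gpartial R n 1 (u 1) \<gamma>"
proof -
  let ?t = "\<lambda>i. gvar_prod R n [1..<Suc i] \<otimes>\<^bsub>grassmann R n\<^esub>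
      fold (gpartial R n) [1..<Suc i] (gpartial R n (i + 1) (u (i + 1)))"
  have v: "gpartial R n (i + 1) (u (i + 1)) \<in> carrier (grassmann R n)" if "i \<in> {1..n - 1}" for i
    using that by (intro gpartial_closed u) auto
  have "(\<Oplus>\<^bsub>grassmann R n\<^esub>i\<in>{1..n - 1}. ?t i) \<gamma> = (\<Oplus>i\<in>{1..n - 1}. ?t i \<gamma>)"
    by (rule gfinsum_apply) (use gsolution_summand_closed \<gamma> in auto)
  also have "\<dots> =
      (\<Oplus>i\<in>{1..n - 1}. if {1..i} \<subseteq> \<gamma> then gpartial R n (i + 1) (u (i + 1)) \<gamma> else \<zero>)"
  proof (rule finsum_cong', simp)
    fix i
    assume i: "i \<in> {1..n - 1}"
    have "set [1..<Suc i] = {1..i}" "{1..i} \<subseteq> {1..n}"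
      using i by auto
    then show "?t i \<gamma> = (if {1..i} \<subseteq> \<gamma> then gpartial R n (i + 1) (u (i + 1)) \<gamma> else \<zero>)"
      using gvar_prod_fold_gpartial_apply[of "[1..<Suc i]" n, OF _ _ v[OF i] \<gamma>]
      by (simp del: upt_Suc)
  qed (use gelem_closed[OF v \<gamma>] in auto)
  finally show ?thesis
    by (simp only: gsolution_def gadd_apply[OF \<gamma>] gvar_prod_mult_gconst_apply[OF c \<gamma>])
qed

text \<open>Each \<partial>_i(u_i) is free of x_i and so has no top coefficient; only the term with
  \<open>c\<close> contributes.\<close>

lemma gsolution_top:
  assumes "c \<in> carrier R"
  shows "gsolution n u c {1..n} = c"
proof -
  have 0: "gpartial R n i (u i) {1..n} = \<zero>" if "i \<in> {1..n}" for i
    using that u by (simp add: gpartial_apply)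
  have sum: "(\<Oplus>i\<in>{1..n - 1}. if {1..i} \<subseteq> {1..n} then gpartial R n (i + 1) (u (i + 1)) {1..n} else \<zero>) = \<zero>"
    by (rule add.finprod_one_eqI) (use 0 in auto)
  have "1 \<in> {1..n}"
    using n by simp
  then show ?thesis
    unfolding gsolution_apply[OF assms subset_refl] sum using 0[of 1] assms by simp
qed

text \<open>Exactly one term of the formula survives at \<open>\<gamma>\<close>, the one built from
  u_m.\<close>

lemma gsolution_least_missing:
  assumes c: "c \<in> carrier R" and \<gamma>: "\<gamma> \<subseteq> {1..n}"
    and m: "m \<in> {1..n}" "m \<notin> \<gamma>" "{1..<m} \<subseteq> \<gamma>"
  shows "gsolution n u c \<gamma> = gpartial R n m (u m) \<gamma>"
proof -
  have v: "gpartial R n i (u i) \<gamma> \<in> carrier R" if "i \<in> {1..n}" for i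
    by (rule gelem_closed[OF gpartial_closed[OF that u[OF that]] \<gamma>])
  have v0: "gpartial R n i (u i) \<gamma> = \<zero>" if "1 \<le> i" "i < m" for i
    using that u m \<gamma> by (subst gpartial_apply) auto
  let ?f = "\<lambda>i. if {1..i} \<subseteq> \<gamma> then gpartial R n (i + 1) (u (i + 1)) \<gamma> else \<zero>"
  \<comment> \<open>For \<open>i + 1 < m\<close> the set \<open>\<gamma>\<close> contains
    \<open>i + 1\<close>, of which \<partial>_(i+1)(u_(i+1)) is free. For \<open>i \<ge> m\<close>
    the set \<open>{1..i}\<close> contains the missing \<open>m\<close>, so the projection kills the
    term.\<close>
  have f0: "?f i = \<zero>" if "1 \<le> i" "i + 1 \<noteq> m" for i
  proof (cases "i + 1 < m")
    case False
    then have "m \<in> {1..i}"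
      using that m by auto
    then show ?thesis
      using m by auto
  qed (use v0[of "i + 1"] in simp)
  have "(\<Oplus>i\<in>{1..n - 1}. ?f i) \<oplus> gpartial R n 1 (u 1) \<gamma> = gpartial R n m (u m) \<gamma>"
  \<comment> \<open>The sum covers only the indices \<open>m = i + 1\<close> from 2 on;
    \<open>m = 1\<close> is served by the separate summand \<partial>_1(u_1).\<close>
  proof (cases "m = 1")
    case True
    have "(\<Oplus>i\<in>{1..n - 1}. ?f i) = \<zero>"
      by (rule add.finprod_one_eqI) (rule f0, use True in auto)
    then show ?thesis
      using v[OF m(1)] True by simp
  next
    case False
    then have m': "m - 1 + 1 = m" "m - 1 \<in> {1..n - 1}" "1 < m"
      using m(1) by auto
    have "{1..m - 1} \<subseteq> \<gamma>"
      using m'(1) by (intro subset_trans[OF _ m(3)]) auto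
    then have fm: "?f (m - 1) = gpartial R n m (u m) \<gamma>"
      using m'(1) by simp
    have "(\<Oplus>i\<in>{1..n - 1}. ?f i) = ?f (m - 1)"
    proof (rule finsum_delta)
      show "?f (m - 1) \<in> carrier R"
        unfolding fm by (rule v[OF m(1)])
      show "?f i = \<zero>" if "i \<in> {1..n - 1}" "i \<noteq> m - 1" for i
        by (rule f0) (use that m' in auto)
    qed (rule finite_atLeastAtMost, rule m'(2))
    then show ?thesis
      unfolding fm using v[OF m(1)] v0[of 1] m'(3) by simp
  qed
  moreover have "(\<Oplus>i\<in>{1..n - 1}. ?f i) \<in> carrier R"
    by (rule finsum_closed) (use v in auto)
  moreover have "(if \<gamma> = {1..n} then c else \<zero>) = \<zero>"
    using m by auto
  ultimately show ?thesis
    unfolding gsolution_apply[OF c \<gamma>] by (simp only: l_zero)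
qed

lemma obtain_least_missing:
  assumes "\<gamma> \<subseteq> {1..n}" "\<gamma> \<noteq> {1..n}"
  obtains m where "m \<in> {1..n}" "m \<notin> \<gamma>" "{1..<m} \<subseteq> \<gamma>"
proof -
  define m where "m = (LEAST m. m \<in> {1..n} - \<gamma>)"
  obtain k where "k \<in> {1..n} - \<gamma>"
    using assms by blast
  then have m: "m \<in> {1..n} - \<gamma>"
    unfolding m_def by (rule LeastI)
  moreover have "k \<in> \<gamma>" if "k \<in> {1..<m}" for k
    using not_less_Least[of k "\<lambda>m. m \<in> {1..n} - \<gamma>", folded m_def] m that by auto
  ultimately show ?thesis
    by (intro that[of m]) auto
qed

section \<open>Uniqueness up to the constant, sufficiency and necessity of the conditions\<close>

text \<open>The free constant is the top coefficient of the given solution. At any other set, the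
  equation for the least missing index \<open>m\<close> forces the coefficient to be that of
  \<partial>_m(u_m), as in the formula.\<close>

lemma gsolution_complete:
  assumes a: "a \<in> carrier (grassmann R n)"
    and eq: "\<forall>i\<in>{1..n}. gvar R n i \<otimes>\<^bsub>grassmann R n\<^esub> a = u i"
  shows "a = gsolution n u (a {1..n})"
proof (rule gelem_eqI[of _ n])
  have c: "a {1..n} \<in> carrier R"
    using a by simp
  then show "gsolution n u (a {1..n}) \<in> carrier (grassmann R n)"
    by (rule gsolution_closed)
  fix \<gamma> :: "nat set"
  assume \<gamma>: "\<gamma> \<subseteq> {1..n}"
  show "a \<gamma> = gsolution n u (a {1..n}) \<gamma>"
  proof (cases "\<gamma> = {1..n}")
    case True
    then show ?thesis
      using gsolution_top[OF c] by simp
  next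
    case False
    then obtain m where m: "m \<in> {1..n}" "m \<notin> \<gamma>" "{1..<m} \<subseteq> \<gamma>"
      by (rule obtain_least_missing[OF \<gamma>])
    have "gvar R n m \<otimes>\<^bsub>grassmann R n\<^esub> a = u m"
      using eq m by blast
    then show ?thesis
      using gsolution_least_missing[OF c \<gamma> m] gvar_mult_eq_iff[OF m(1) a u[OF m(1)]] \<gamma> m by simp
  qed
qed (rule a)

text \<open>At a set without \<open>k\<close> the formula takes its coefficient from u_m with
  \<open>m\<close> least missing, whereas equation \<open>k\<close> asks for that of
  \<partial>_k(u_k). Either \<open>m = k\<close>, or \<open>m < k\<close> and
  \<open>gpartial_compatible\<close> identifies the two.\<close>

lemma gsolution_solves:
  assumes c: "c \<in> carrier R"
    and ideal: "\<forall>i\<in>{1..n}. u i \<in> Idl\<^bsub>grassmann R n\<^esub> {gvar R n i}"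
    and rel: "\<forall>i\<in>{1..n}. \<forall>j\<in>{1..n}. i \<noteq> j \<longrightarrow> gvar R n i \<otimes>\<^bsub>grassmann R n\<^esub> u j =
      \<ominus>\<^bsub>grassmann R n\<^esub> (gvar R n j \<otimes>\<^bsub>grassmann R n\<^esub> u i)"
    and k: "k \<in> {1..n}"
  shows "gvar R n k \<otimes>\<^bsub>grassmann R n\<^esub> gsolution n u c = u k"
  unfolding gvar_mult_eq_iff[OF k gsolution_closed[OF c] u[OF k]]
proof (intro conjI allI impI)
  show "u k \<in> Idl\<^bsub>grassmann R n\<^esub> {gvar R n k}"
    using ideal k by blast
  fix \<gamma>
  assume \<gamma>: "\<gamma> \<subseteq> {1..n}" "k \<notin> \<gamma>"
  then have "\<gamma> \<noteq> {1..n}"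
    using k by blast
  then obtain m where m: "m \<in> {1..n}" "m \<notin> \<gamma>" "{1..<m} \<subseteq> \<gamma>"
    by (rule obtain_least_missing[OF \<gamma>(1)])
  \<comment> \<open>Otherwise \<open>k\<close> would lie in \<open>{1..<m}\<close> and hence in
    \<open>\<gamma>\<close>.\<close>
  have "\<not> k < m"
    using \<gamma>(2) k m(3) by (meson atLeastAtMost_iff atLeastLessThan_iff subsetD)
  then have "m = k \<or> m < k"
    by linarith
  moreover have "gpartial R n m (u m) \<gamma> = gpartial R n k (u k) \<gamma>" if "m < k"
    by (rule gpartial_compatible[OF m(1) k that u[OF m(1)] u[OF k]
          rel[rule_format, OF m(1) k less_imp_neq[OF that]] \<gamma>(1) m(2) \<gamma>(2)])
  ultimately show "gsolution n u c \<gamma> = gpartial R n k (u k) \<gamma>"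
    using gsolution_least_missing[OF c \<gamma>(1) m] by auto
qed

text \<open>The relations come from x_i u_j = x_i x_j a = -x_j x_i a = -x_j u_i, the ideal
  membership from u_i = x_i a.\<close>

lemma gsystem_necessary:
  assumes a: "a \<in> carrier (grassmann R n)"
    and eq: "\<forall>i\<in>{1..n}. gvar R n i \<otimes>\<^bsub>grassmann R n\<^esub> a = u i"
  shows "\<forall>i\<in>{1..n}. u i \<in> Idl\<^bsub>grassmann R n\<^esub> {gvar R n i}"
    and "\<forall>i\<in>{1..n}. \<forall>j\<in>{1..n}. i \<noteq> j \<longrightarrow> gvar R n i \<otimes>\<^bsub>grassmann R n\<^esub> u j =
      \<ominus>\<^bsub>grassmann R n\<^esub> (gvar R n j \<otimes>\<^bsub>grassmann R n\<^esub> u i)"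
proof -
  show "\<forall>i\<in>{1..n}. u i \<in> Idl\<^bsub>grassmann R n\<^esub> {gvar R n i}"
  proof
    fix i
    assume i: "i \<in> {1..n}"
    then have "gvar R n i \<otimes>\<^bsub>grassmann R n\<^esub> a = u i"
      using eq by blast
    then show "u i \<in> Idl\<^bsub>grassmann R n\<^esub> {gvar R n i}"
      unfolding gvar_mult_eq_iff[OF i a u[OF i]] by (rule conjunct1)
  qed
  show "\<forall>i\<in>{1..n}. \<forall>j\<in>{1..n}. i \<noteq> j \<longrightarrow> gvar R n i \<otimes>\<^bsub>grassmann R n\<^esub> u j =
      \<ominus>\<^bsub>grassmann R n\<^esub> (gvar R n j \<otimes>\<^bsub>grassmann R n\<^esub> u i)"
  proof (intro ballI impI)
    fix i j
    assume ij: "i \<in> {1..n}" "j \<in> {1..n}" "i \<noteq> j"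
    let ?L = "grassmann R n"
    have "gvar R n i \<otimes>\<^bsub>?L\<^esub> u j = (gvar R n i \<otimes>\<^bsub>?L\<^esub> gvar R n j) \<otimes>\<^bsub>?L\<^esub> a"
      using eq ij a by (simp add: Gr.m_assoc)
    also have "\<dots> = \<ominus>\<^bsub>?L\<^esub> (gvar R n j \<otimes>\<^bsub>?L\<^esub> (gvar R n i \<otimes>\<^bsub>?L\<^esub> a))"
      unfolding gvar_anticommute[OF ij(3)] using a by (simp add: Gr.l_minus Gr.m_assoc)
    finally show "gvar R n i \<otimes>\<^bsub>?L\<^esub> u j = \<ominus>\<^bsub>?L\<^esub> (gvar R n j \<otimes>\<^bsub>?L\<^esub> u i)"
      using eq ij by simp
  qed
qed

end

end


theorem theorem8p2:
  fixes K :: "('a, 'm) ring_scheme" and n :: nat and u :: "nat \<Rightarrow> nat set \<Rightarrow> 'a"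
  assumes "ring K" and "n \<ge> 1"
    and "\<And>i. i \<in> {1..n} \<Longrightarrow> u i \<in> carrier (grassmann K n)"
  shows
    "let L = grassmann K n; x = gvar K n; D = gpartial K n;
         solutions = {a \<in> carrier L. \<forall>i\<in>{1..n}. x i \<otimes>\<^bsub>L\<^esub> a = u i};
         conditions =
           ((\<forall>i\<in>{1..n}. u i \<in> Idl\<^bsub>L\<^esub> {x i}) \<and>
            (\<forall>i\<in>{1..n}. \<forall>j\<in>{1..n}. i \<noteq> j \<longrightarrow> x i \<otimes>\<^bsub>L\<^esub> u j = \<ominus>\<^bsub>L\<^esub> (x j \<otimes>\<^bsub>L\<^esub> u i)))
     in (solutions \<noteq> {} \<longleftrightarrow> conditions) \<and>
        (conditions \<longrightarrow>
          solutions =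
            {gvar_prod K n [1..<Suc n] \<otimes>\<^bsub>L\<^esub> gconst K n c
             \<oplus>\<^bsub>L\<^esub> (\<Oplus>\<^bsub>L\<^esub>i\<in>{1..n - 1}. gvar_prod K n [1..<Suc i] \<otimes>\<^bsub>L\<^esub> fold D [1..<Suc i] (D (i + 1) (u (i + 1))))
             \<oplus>\<^bsub>L\<^esub> D 1 (u 1) | c. c \<in> carrier K})"
proof -
  interpret ring K
    by (rule assms(1))
  let ?L = "grassmann K n" and ?x = "gvar K n"
  let ?solutions = "{a \<in> carrier ?L. \<forall>i\<in>{1..n}. ?x i \<otimes>\<^bsub>?L\<^esub> a = u i}"
  let ?conditions = "(\<forall>i\<in>{1..n}. u i \<in> Idl\<^bsub>?L\<^esub> {?x i}) \<and>
    (\<forall>i\<in>{1..n}. \<forall>j\<in>{1..n}. i \<noteq> j \<longrightarrow> ?x i \<otimes>\<^bsub>?L\<^esub> u j = \<ominus>\<^bsub>?L\<^esub> (?x j \<otimes>\<^bsub>?L\<^esub> u i))"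
  have nec: ?conditions if nonempty: "?solutions \<noteq> {}"
  proof -
    obtain a where "a \<in> carrier ?L" "\<forall>i\<in>{1..n}. ?x i \<otimes>\<^bsub>?L\<^esub> a = u i"
      using nonempty by blast
    from gsystem_necessary[where u = u, OF assms(2,3) this] show ?thesis
      by (rule conjI)
  qed
  have suf: "?solutions = {gsolution n u c | c. c \<in> carrier K}" if cond: ?conditions
  proof (intro equalityI subsetI)
    fix a
    assume "a \<in> ?solutions"
    then have "a = gsolution n u (a {1..n})" "a {1..n} \<in> carrier K"
      using gsolution_complete[where u = u, OF assms(2,3), of a] by auto
    then show "a \<in> {gsolution n u c | c. c \<in> carrier K}"
      by blast
  next
    fix a
    assume "a \<in> {gsolution n u c | c. c \<in> carrier K}"
    then obtain c where c: "c \<in> carrier K" and a: "a = gsolution n u c"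
      by blast
    have "a \<in> carrier ?L"
      unfolding a by (rule gsolution_closed[where u = u, OF assms(2,3) c])
    moreover have "?x i \<otimes>\<^bsub>?L\<^esub> a = u i" if "i \<in> {1..n}" for i
      unfolding a by (rule gsolution_solves[where u = u, OF assms(2,3) c conjunct1[OF cond]
            conjunct2[OF cond] that])
    ultimately show "a \<in> ?solutions"
      by blast
  qed
  \<comment> \<open>Solvability follows from the description of the solution set, since the constant
    may be taken to be zero.\<close>
  have ne: "?solutions \<noteq> {}" if ?conditions
    unfolding suf[OF that] using zero_closed by blast
  have "(?solutions \<noteq> {} \<longleftrightarrow> ?conditions) \<and>
      (?conditions \<longrightarrow> ?solutions = {gsolution n u c | c. c \<in> carrier K})"
    by (rule conjI[OF iffI[OF nec ne] impI[OF suf]])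
  then show ?thesis
    unfolding Let_def gsolution_def .
qed

end
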